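(* Let $0<\alpha\le 1$, $p,q>0$, and let $g\in L^\infty(0,1)$ be real-valued with $g\ge 0$. Let $\lambda_1<\lambda_2<\dots$ be the eigenvalues of $-\mathcal{L}^*$, where $\mathcal{L}^*v=v''-gv$ with domain $H^2(0,1)\cap H^1_0(0,1)$, and set $$\Delta_k=E_{\alpha,1}(-\lambda_k q^\alpha)-\sqrt{\lambda_k}\,\sin(\sqrt{\lambda_k}\,p)-\cos(\sqrt{\lambda_k}\,p),\qquad k\ge 1 .$$ Suppose $\Delta_k\neq 0$ for every $k\ge 1$. Then, for given data $\varphi,\psi$, the solution of Problem 1 (defined in the context) is unique: there is at most one pair $\{u,f\}$ solving Problem 1 with data $\varphi,\psi$.
   Context: $E_{\alpha,\beta}(z)=\sum_{n\ge 0} z^n/\Gamma(\alpha n+\beta)$ is the Mittag-Leffler function. Since $g\ge 0$, all eigenvalues $\lambda_k$ of $-\mathcal{L}^*$ (i.e. $\mathcal{L}^*\omega_k=-\lambda_k\omega_k$) are positive and simple, and the eigenfunctions $\omega_k$, normalized in $L^2(0,1)$, form an orthonormal basis of $L^2(0,1)$. Write $\mathcal{D}^*(\mathcal{L}^* )=H^2(0,1)\cap H_0^1(0,1)$ (with the $H^2$ norm) and $(\cdot,\cdot)$ for the $L^2(0,1)$ scalar product. For $0<\alpha<1$ and $t>0$ the Caputo derivative is ${}_CD_{0t}^\alpha u(t)=\frac{1}{\Gamma(1-\alpha)}\int_0^t (t-s)^{-\alpha}\,\partial_s u(s)\,ds$; for $\alpha=1$ it is $\partial_t u$. Problem 1 (with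 data $\varphi,\psi$): find a pair $\{u,f\}$ with $f=f(x)\in L^2(0,1)$ and $u=u(x,t)$ on $(0,1)\times[-p,q]$, with $u(\cdot,t)\in\mathcal{D}^*(\mathcal{L}^* )$ for $t\in[-p,q]$, such that (a) $u\in C([-p,q];\mathcal{D}^*(\mathcal{L}^* ))$; $\partial_t u\in C([-p,0]\cup(0,q];L^2(0,1))$, where $\partial_t u(\cdot,0)$ is the derivative from the left (no continuity of $\partial_t u$ as $t\to 0^+$ is required); ${}_CD_{0t}^\alpha u\in C([0,q];L^2(0,1))$; $\partial_t^2u\in C((-p,0);L^2(0,1))$; (b) $\lim_{t\to -p}\|u(\cdot,t)-\psi\|_{\mathcal{D}^*(\mathcal{L}^* )}=0$ and $\lim_{t\to q}\|u(\cdot,t)-\varphi\|_{\mathcal{D}^*(\mathcal{L}^* )}=0$; (c) (gluing condition) $\lim_{t\to +0}{}_CD_{0t}^\alpha u(\cdot,t)=\lim_{t\to -0}\partial_t u(\cdot,t)$ in $L^2(0,1)$; (d) $({}_CD_{0t}^\alpha u,\eta)-(\mathcal{L}^*u,\eta)=(f,\eta)$ for $t\in[0,q]$ and all $\eta\in\mathcal{D}^*(\mathcal{L}^* )$; (e) $(\partial_t^2u,\eta)-(\mathcal{L}^*u,\eta)=(f,\eta)$ for $t\in(-p,0)$ and all $\eta\in\mathcal{D}^*(\mathcal{L}^* )$. *)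

theory Defs
  imports "HOL-Analysis.Analysis"
begin

text \<open>The type \<open>L2\<close> is \<open>L\<^sup>2(0,1)\<close>: real square-integrable functions modulo equality almost
  everywhere. The instances \<open>banach\<close> and \<open>second_countable_topology\<close> (completeness and separability)
  make the library's Bochner integral available for \<open>L2\<close>-valued functions of time.\<close>

abbreviation unit_meas :: "real measure" where
  "unit_meas \<equiv> lebesgue_on {0<..<1}"

definition sq_integrable :: "(real \<Rightarrow> real) \<Rightarrow> bool" where
  "sq_integrable f \<longleftrightarrow> f \<in> borel_measurable unit_meas \<and> integrable unit_meas (\<lambda>x. (f x)\<^sup>2)"

lemma sq_integrableD [dest]:
  assumes "sq_integrable f"
  shows "f \<in> borel_measurable unit_meas" "integrable unit_meas (\<lambda>x. (f x)\<^sup>2)"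
  using assms by (auto simp: sq_integrable_def)

lemma finite_measure_unit: "finite_measure unit_meas"
  by (rule finite_measureI) (simp add: emeasure_restrict_space space_restrict_space)

lemma sq_integrable_const: "sq_integrable (\<lambda>x. c)"
  using finite_measure.integrable_const[OF finite_measure_unit] by (simp add: sq_integrable_def)

lemma integrable_mult_sq:
  assumes f: "sq_integrable f" and g: "sq_integrable g"
  shows "integrable unit_meas (\<lambda>x. f x * g x)"
proof (rule Bochner_Integration.integrable_bound)
  show "integrable unit_meas (\<lambda>x. (f x)\<^sup>2 + (g x)\<^sup>2)"
    using f g by (auto simp: sq_integrable_def)
  show "(\<lambda>x. f x * g x) \<in> borel_measurable unit_meas"
    using f g by (auto simp: sq_integrable_def)
  have "\<bar>a * b\<bar> \<le> \<bar>a\<^sup>2 + b\<^sup>2\<bar>" for a b :: real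
  proof -
    have "2 * (\<bar>a\<bar> * \<bar>b\<bar>) \<le> \<bar>a\<bar>\<^sup>2 + \<bar>b\<bar>\<^sup>2"
      using sum_squares_bound[of "\<bar>a\<bar>" "\<bar>b\<bar>"] by simp
    moreover have "0 \<le> \<bar>a\<bar> * \<bar>b\<bar>" by simp
    ultimately have "\<bar>a\<bar> * \<bar>b\<bar> \<le> a\<^sup>2 + b\<^sup>2" unfolding power2_abs by linarith
    then show ?thesis by (simp add: abs_mult)
  qed
  then show "AE x in unit_meas. norm (f x * g x) \<le> norm ((f x)\<^sup>2 + (g x)\<^sup>2)"
    by simp
qed

lemma sq_integrable_integrable:
  assumes "sq_integrable f" shows "integrable unit_meas f"
  using integrable_mult_sq[OF assms sq_integrable_const[of 1]] by simp

lemma sq_integrable_add: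
  assumes f: "sq_integrable f" and g: "sq_integrable g"
  shows "sq_integrable (\<lambda>x. f x + g x)"
proof -
  have "integrable unit_meas (\<lambda>x. (f x)\<^sup>2 + (g x)\<^sup>2 + 2 * (f x * g x))"
    using f g integrable_mult_sq[OF f g]
    by (intro Bochner_Integration.integrable_add integrable_mult_right) (auto simp: sq_integrable_def)
  then show ?thesis
    using f g by (auto simp: sq_integrable_def power2_sum mult.assoc)
qed

lemma sq_integrable_scale:
  assumes f: "sq_integrable f" shows "sq_integrable (\<lambda>x. c * f x)"
  using f by (auto simp: sq_integrable_def power_mult_distrib)

lemma sq_integrable_minus:
  assumes f: "sq_integrable f" shows "sq_integrable (\<lambda>x. - f x)"
  using f by (auto simp: sq_integrable_def)

lemma sq_integrable_diff:
  assumes f: "sq_integrable f" and g: "sq_integrable g"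
  shows "sq_integrable (\<lambda>x. f x - g x)"
  using sq_integrable_add[OF f sq_integrable_minus[OF g]] by simp

lemma sq_integrable_AE_bound:
  assumes f: "sq_integrable f" and g: "g \<in> borel_measurable unit_meas"
    and le: "AE x in unit_meas. \<bar>g x\<bar> \<le> \<bar>f x\<bar>"
  shows "sq_integrable g"
proof -
  have "integrable unit_meas (\<lambda>x. (g x)\<^sup>2)"
  proof (rule Bochner_Integration.integrable_bound)
    show "integrable unit_meas (\<lambda>x. (f x)\<^sup>2)" using f by auto
    show "(\<lambda>x. (g x)\<^sup>2) \<in> borel_measurable unit_meas" using g by simp
    show "AE x in unit_meas. norm ((g x)\<^sup>2) \<le> norm ((f x)\<^sup>2)"
      using le by eventually_elim (simp add: abs_le_square_iff)
  qed
  then show ?thesis using g by (simp add: sq_integrable_def)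
qed

quotient_type L2 = "real \<Rightarrow> real" / partial:
  "\<lambda>f g. sq_integrable f \<and> sq_integrable g \<and> (AE x in unit_meas. f x = g x)"
  morphisms rep_L2 abs_L2
proof (rule part_equivpI)
  show "\<exists>f. sq_integrable f \<and> sq_integrable f \<and> (AE x in unit_meas. f x = f x)"
    using sq_integrable_const by auto
  show "symp (\<lambda>f g. sq_integrable f \<and> sq_integrable g \<and> (AE x in unit_meas. f x = g x))"
    by (rule sympI) (auto simp: eq_commute)
  show "transp (\<lambda>f g. sq_integrable f \<and> sq_integrable g \<and> (AE x in unit_meas. f x = g x))"
    by (rule transpI) (auto elim: eventually_elim2)
qed

instantiation L2 :: real_vector
begin

lift_definition zero_L2 :: L2 is "\<lambda>x. 0"
  by (simp add: sq_integrable_const)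

lift_definition plus_L2 :: "L2 \<Rightarrow> L2 \<Rightarrow> L2" is "\<lambda>f g x. f x + g x"
  by (auto intro: sq_integrable_add elim: eventually_elim2)

lift_definition minus_L2 :: "L2 \<Rightarrow> L2 \<Rightarrow> L2" is "\<lambda>f g x. f x - g x"
  by (auto intro: sq_integrable_diff elim: eventually_elim2)

lift_definition uminus_L2 :: "L2 \<Rightarrow> L2" is "\<lambda>f x. - f x"
  by (auto intro: sq_integrable_minus)

lift_definition scaleR_L2 :: "real \<Rightarrow> L2 \<Rightarrow> L2" is "\<lambda>c f x. c * f x"
  by (auto intro: sq_integrable_scale elim: eventually_mono)

instance
proof
  fix a b c :: L2 and r s :: real
  show "a + b + c = a + (b + c)"
    by transfer (auto intro!: sq_integrable_add simp: algebra_simps)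
  show "a + b = b + a"
    by transfer (auto intro!: sq_integrable_add simp: algebra_simps)
  show "0 + a = a"
    by transfer auto
  show "- a + a = 0"
    by transfer (auto intro!: sq_integrable_const)
  show "a - b = a + - b"
    by transfer (auto intro!: sq_integrable_diff)
  show "r *\<^sub>R (a + b) = r *\<^sub>R a + r *\<^sub>R b"
    by transfer (auto intro!: sq_integrable_add sq_integrable_scale simp: algebra_simps)
  show "(r + s) *\<^sub>R a = r *\<^sub>R a + s *\<^sub>R a"
    by transfer (auto intro!: sq_integrable_add sq_integrable_scale simp: algebra_simps)
  show "r *\<^sub>R s *\<^sub>R a = (r * s) *\<^sub>R a"
    by transfer (auto intro!: sq_integrable_scale simp: algebra_simps)
  show "1 *\<^sub>R a = a"
    by transfer auto
qed

end

instantiation L2 :: real_inner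
begin

lift_definition inner_L2 :: "L2 \<Rightarrow> L2 \<Rightarrow> real" is "\<lambda>f g. LINT x|unit_meas. f x * g x"
proof -
  fix f f' g g' :: "real \<Rightarrow> real"
  assume f: "sq_integrable f \<and> sq_integrable f' \<and> (AE x in unit_meas. f x = f' x)"
    and g: "sq_integrable g \<and> sq_integrable g' \<and> (AE x in unit_meas. g x = g' x)"
  have "AE x in unit_meas. f x * g x = f' x * g' x"
    using conjunct2[OF conjunct2[OF f]] conjunct2[OF conjunct2[OF g]] by eventually_elim simp
  then show "(LINT x|unit_meas. f x * g x) = (LINT x|unit_meas. f' x * g' x)"
    using f g by (intro integral_cong_AE borel_measurable_times) auto
qed

definition norm_L2 :: "L2 \<Rightarrow> real" where "norm_L2 v = sqrt (inner v v)"
definition sgn_L2 :: "L2 \<Rightarrow> L2" where "sgn_L2 v = v /\<^sub>R norm v"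
definition dist_L2 :: "L2 \<Rightarrow> L2 \<Rightarrow> real" where "dist_L2 v w = norm (v - w)"
definition uniformity_L2 :: "(L2 \<times> L2) filter" where
  "uniformity_L2 = (INF e\<in>{0 <..}. principal {(v, w). dist v w < e})"
definition open_L2 :: "L2 set \<Rightarrow> bool" where
  "open_L2 U \<longleftrightarrow> (\<forall>v\<in>U. \<forall>\<^sub>F (v', w) in uniformity. v' = v \<longrightarrow> w \<in> U)"

instance
proof
  fix a b c :: L2 and r :: real and U :: "L2 set"
  show "sgn a = a /\<^sub>R norm a" by (simp add: sgn_L2_def)
  show "dist a b = norm (a - b)" by (simp add: dist_L2_def)
  show "(uniformity :: (L2 \<times> L2) filter) = (INF e\<in>{0 <..}. principal {(v, w). dist v w < e})"
    by (simp add: uniformity_L2_def)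
  show "open U \<longleftrightarrow> (\<forall>v\<in>U. \<forall>\<^sub>F (v', w) in uniformity. v' = v \<longrightarrow> w \<in> U)"
    by (simp add: open_L2_def)
  show "inner a b = inner b a"
    by transfer (simp add: mult.commute)
  show "inner (a + b) c = inner a c + inner b c"
    by transfer (simp add: algebra_simps integrable_mult_sq)
  show "inner (r *\<^sub>R a) b = r * inner a b"
    by transfer (simp add: algebra_simps)
  show "0 \<le> inner a a"
    by transfer simp
  show "inner a a = 0 \<longleftrightarrow> a = 0"
  proof transfer
    fix f assume "sq_integrable f \<and> sq_integrable f \<and> (AE x in unit_meas. f x = f x)"
    then have f: "sq_integrable f" by simp
    have "(LINT x|unit_meas. f x * f x) = 0 \<longleftrightarrow> (AE x in unit_meas. f x * f x = 0)"
      by (rule integral_nonneg_eq_0_iff_AE) (auto intro: integrable_mult_sq f)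
    then show "(LINT x|unit_meas. f x * f x) = 0 \<longleftrightarrow>
        (sq_integrable f \<and> sq_integrable (\<lambda>x. 0) \<and> (AE x in unit_meas. f x = 0))"
      using f by (simp add: sq_integrable_const)
  qed
  show "norm a = sqrt (inner a a)" by (simp add: norm_L2_def)
qed

end

lemma sq_integrable_rep [simp]: "sq_integrable (rep_L2 v)"
  using Quotient_rep_reflp[OF Quotient_L2, of v] by simp

lemma abs_rep_L2 [simp]: "abs_L2 (rep_L2 v) = v"
  by (rule Quotient_abs_rep[OF Quotient_L2])

lemma rep_abs_L2: "sq_integrable f \<Longrightarrow> AE x in unit_meas. rep_L2 (abs_L2 f) x = f x"
  using Quotient_rep_abs[OF Quotient_L2, of f] by simp

lemma abs_L2_eq_iff:
  "sq_integrable f \<Longrightarrow> sq_integrable g \<Longrightarrow> abs_L2 f = abs_L2 g \<longleftrightarrow> (AE x in unit_meas. f x = g x)"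
  using Quotient_rel[OF Quotient_L2, of f g] by auto

lemma plus_abs_L2: "sq_integrable f \<Longrightarrow> sq_integrable g \<Longrightarrow> abs_L2 f + abs_L2 g = abs_L2 (\<lambda>x. f x + g x)"
  by (rule plus_L2.abs_eq) auto

lemma minus_abs_L2: "sq_integrable f \<Longrightarrow> sq_integrable g \<Longrightarrow> abs_L2 f - abs_L2 g = abs_L2 (\<lambda>x. f x - g x)"
  by (rule minus_L2.abs_eq) auto

lemma scaleR_abs_L2: "sq_integrable f \<Longrightarrow> c *\<^sub>R abs_L2 f = abs_L2 (\<lambda>x. c * f x)"
  by (rule scaleR_L2.abs_eq) auto

lemma inner_abs_L2: "sq_integrable f \<Longrightarrow> sq_integrable g \<Longrightarrow> inner (abs_L2 f) (abs_L2 g) = (LINT x|unit_meas. f x * g x)"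
  by (rule inner_L2.abs_eq) auto

lemma norm_abs_L2: "sq_integrable f \<Longrightarrow> norm (abs_L2 f) = sqrt (LINT x|unit_meas. (f x)\<^sup>2)"
  by (simp add: norm_eq_sqrt_inner inner_abs_L2 power2_eq_square)

lemma L2_cases: obtains f where "v = abs_L2 f" "sq_integrable f"
  using abs_rep_L2 sq_integrable_rep by metis

lemma tendsto_abs_L2:
  assumes s: "\<And>n. sq_integrable (s n)" and f: "sq_integrable f"
    and lim: "(\<lambda>n. LINT x|unit_meas. (s n x - f x)\<^sup>2) \<longlonglongrightarrow> 0"
  shows "(\<lambda>n. abs_L2 (s n)) \<longlonglongrightarrow> abs_L2 f"
proof -
  have "(\<lambda>n. norm (abs_L2 (s n) - abs_L2 f)) \<longlonglongrightarrow> 0"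
    using tendsto_real_sqrt[OF lim] by (simp add: minus_abs_L2 norm_abs_L2 s f sq_integrable_diff)
  then show ?thesis by (simp add: LIM_zero_cancel tendsto_norm_zero_iff)
qed

lemma tendsto_abs_L2_dominated:
  assumes s: "\<And>n. s n \<in> borel_measurable unit_meas" and f: "f \<in> borel_measurable unit_meas"
    and h: "sq_integrable h"
    and lim: "AE x in unit_meas. (\<lambda>n. s n x) \<longlonglongrightarrow> f x"
    and sb: "\<And>n. AE x in unit_meas. \<bar>s n x\<bar> \<le> \<bar>h x\<bar>" and fb: "AE x in unit_meas. \<bar>f x\<bar> \<le> \<bar>h x\<bar>"
  shows "(\<lambda>n. abs_L2 (s n)) \<longlonglongrightarrow> abs_L2 f"
proof (rule tendsto_abs_L2)
  show "sq_integrable (s n)" for n by (rule sq_integrable_AE_bound[OF h s sb])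
  show "sq_integrable f" by (rule sq_integrable_AE_bound[OF h f fb])
  have "(\<lambda>n. LINT x|unit_meas. (s n x - f x)\<^sup>2) \<longlonglongrightarrow> (LINT x|unit_meas. 0)"
  proof (rule integral_dominated_convergence)
    show "integrable unit_meas (\<lambda>x. 4 * (h x)\<^sup>2)" using h by auto
    show "AE x in unit_meas. (\<lambda>n. (s n x - f x)\<^sup>2) \<longlonglongrightarrow> 0"
      using lim
    proof eventually_elim
      case (elim x)
      have "(\<lambda>n. (s n x - f x)\<^sup>2) \<longlonglongrightarrow> (f x - f x)\<^sup>2"
        using elim by (intro tendsto_intros)
      then show ?case by simp
    qed
    show "AE x in unit_meas. norm ((s n x - f x)\<^sup>2) \<le> 4 * (h x)\<^sup>2" for n
      using sb[of n] fb
    proof eventually_elim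
      case (elim x)
      then have "\<bar>s n x - f x\<bar> \<le> \<bar>2 * h x\<bar>" by simp
      then have "(s n x - f x)\<^sup>2 \<le> (2 * h x)\<^sup>2" by (simp only: abs_le_square_iff)
      then show ?case by (simp add: power_mult_distrib)
    qed
  qed (use s f in auto)
  then show "(\<lambda>n. LINT x|unit_meas. (s n x - f x)\<^sup>2) \<longlonglongrightarrow> 0" by simp
qed

instance L2 :: complete_space
proof
  fix X :: "nat \<Rightarrow> L2" assume X: "Cauchy X"
  define s where "s n = rep_L2 (X n)" for n
  have s: "sq_integrable (s n)" for n by (simp add: s_def)
  have Xs: "X n = abs_L2 (s n)" for n by (simp add: s_def)
  have [measurable]: "s n \<in> borel_measurable unit_meas" for n using s by auto
  have d: "dist (X i) (X j) = sqrt (LINT x|unit_meas. (s i x - s j x)\<^sup>2)" for i j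
    by (simp add: Xs dist_norm minus_abs_L2 s norm_abs_L2 sq_integrable_diff)
  have L1: "(LINT x|unit_meas. norm (s i x - s j x)) \<le> dist (X i) (X j)" for i j
  proof -
    have sd: "sq_integrable (\<lambda>x. \<bar>s i x - s j x\<bar>)"
      by (rule sq_integrable_AE_bound[OF sq_integrable_diff[OF s[of i] s[of j]]]) auto
    have "(LINT x|unit_meas. norm (s i x - s j x)) = inner (abs_L2 (\<lambda>x. \<bar>s i x - s j x\<bar>)) (abs_L2 (\<lambda>x. 1))"
      by (simp add: inner_abs_L2 sd sq_integrable_const)
    also have "\<dots> \<le> norm (abs_L2 (\<lambda>x. \<bar>s i x - s j x\<bar>)) * norm (abs_L2 (\<lambda>x. 1))"
      by (rule norm_cauchy_schwarz)
    also have "norm (abs_L2 (\<lambda>x. 1)) = 1"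
      by (simp add: norm_abs_L2 sq_integrable_const measure_restrict_space space_restrict_space)
    finally show ?thesis by (simp add: norm_abs_L2 sd d)
  qed
  obtain r where r: "strict_mono r" "AE x in unit_meas. Cauchy (\<lambda>i. s (r i) x)"
  proof (rule cauchy_L1_AE_cauchy_subseq)
    show "integrable unit_meas (s n)" for n using s by (rule sq_integrable_integrable)
    fix e :: real assume "e > 0"
    then obtain N where "\<forall>i\<ge>N. \<forall>j\<ge>N. dist (X i) (X j) < e"
      using X unfolding Cauchy_def by blast
    then show "\<exists>N. \<forall>i\<ge>N. \<forall>j\<ge>N. (LINT x|unit_meas. norm (s i x - s j x)) < e"
      using L1 by (meson le_less_trans)
  qed
  define g where "g x = lim (\<lambda>i. s (r i) x)" for x
  have [measurable]: "g \<in> borel_measurable unit_meas"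
    unfolding g_def by measurable
  have g: "AE x in unit_meas. (\<lambda>i. s (r i) x) \<longlonglongrightarrow> g x"
    using r(2) by eventually_elim (auto simp: g_def Cauchy_convergent_iff convergent_LIMSEQ_iff)
  have key: "(\<integral>\<^sup>+x. ennreal ((g x - s m x)\<^sup>2) \<partial>unit_meas) \<le> ennreal (e\<^sup>2)"
    if "e > 0" and N: "\<forall>i\<ge>N. \<forall>j\<ge>N. dist (X i) (X j) < e" and m: "m \<ge> N" for e N m
  proof -
    have "(\<integral>\<^sup>+x. ennreal ((g x - s m x)\<^sup>2) \<partial>unit_meas)
        = (\<integral>\<^sup>+x. liminf (\<lambda>i. ennreal ((s (r i) x - s m x)\<^sup>2)) \<partial>unit_meas)"
    proof (rule nn_integral_cong_AE, use g in eventually_elim)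
      case (elim x)
      have "(\<lambda>i. ennreal ((s (r i) x - s m x)\<^sup>2)) \<longlonglongrightarrow> ennreal ((g x - s m x)\<^sup>2)"
        using elim by (intro tendsto_intros tendsto_ennrealI)
      then show ?case by (rule lim_imp_Liminf[OF sequentially_bot, symmetric])
    qed
    also have "\<dots> \<le> liminf (\<lambda>i. \<integral>\<^sup>+x. ennreal ((s (r i) x - s m x)\<^sup>2) \<partial>unit_meas)"
      by (rule nn_integral_liminf) simp
    also have "\<dots> \<le> ennreal (e\<^sup>2)"
    proof (rule Liminf_le)
      show "\<forall>\<^sub>F i in sequentially. (\<integral>\<^sup>+x. ennreal ((s (r i) x - s m x)\<^sup>2) \<partial>unit_meas) \<le> ennreal (e\<^sup>2)"
        using eventually_ge_at_top[of N]
      proof eventually_elim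
        case (elim i)
        have "r i \<ge> N" using elim r(1) by (meson le_trans seq_suble)
        then have "sqrt (LINT x|unit_meas. (s (r i) x - s m x)\<^sup>2) < e"
          using N m by (simp add: d)
        then have "(LINT x|unit_meas. (s (r i) x - s m x)\<^sup>2) \<le> e\<^sup>2"
          using real_less_lsqrt real_sqrt_less_iff sqrt_le_D by (meson less_imp_le)
        moreover have "integrable unit_meas (\<lambda>x. (s (r i) x - s m x)\<^sup>2)"
          using sq_integrable_diff[OF s[of "r i"] s[of m]] by auto
        ultimately show ?case by (simp add: nn_integral_eq_integral ennreal_leI)
      qed
    qed simp
    finally show ?thesis .
  qed
  have gs: "sq_integrable (\<lambda>x. g x - s m x) \<and> (LINT x|unit_meas. (g x - s m x)\<^sup>2) \<le> e\<^sup>2"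
    if "e > 0" and N: "\<forall>i\<ge>N. \<forall>j\<ge>N. dist (X i) (X j) < e" and m: "m \<ge> N" for e N m
  proof -
    have i: "integrable unit_meas (\<lambda>x. (g x - s m x)\<^sup>2)"
      using key[OF that] by (intro integrableI_bounded) (auto simp: le_less_trans)
    have "ennreal (LINT x|unit_meas. (g x - s m x)\<^sup>2) \<le> ennreal (e\<^sup>2)"
      using key[OF that] i by (simp add: nn_integral_eq_integral)
    then show ?thesis using i by (simp add: sq_integrable_def)
  qed
  obtain N1 where "\<forall>i\<ge>N1. \<forall>j\<ge>N1. dist (X i) (X j) < 1"
    using X unfolding Cauchy_def by (meson zero_less_one)
  then have "sq_integrable (\<lambda>x. g x - s N1 x)" using gs[of 1 N1 N1] by simp
  from sq_integrable_add[OF this s[of N1]] have g2: "sq_integrable g" by simp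
  have "X \<longlonglongrightarrow> abs_L2 g"
  proof (rule metric_LIMSEQ_I)
    fix e :: real assume e: "e > 0"
    then obtain N where N: "\<forall>i\<ge>N. \<forall>j\<ge>N. dist (X i) (X j) < e/2"
      using X unfolding Cauchy_def by (meson half_gt_zero)
    have "dist (X n) (abs_L2 g) < e" if "n \<ge> N" for n
    proof -
      have "dist (X n) (abs_L2 g) = sqrt (LINT x|unit_meas. (g x - s n x)\<^sup>2)"
        by (subst dist_commute) (simp add: Xs dist_norm minus_abs_L2 s g2 norm_abs_L2 sq_integrable_diff)
      also have "\<dots> \<le> sqrt ((e/2)\<^sup>2)"
        using gs[OF _ N that] e by (intro real_sqrt_le_mono) simp
      also have "\<dots> < e" using e by simp
      finally show ?thesis .
    qed
    then show "\<exists>N. \<forall>n\<ge>N. dist (X n) (abs_L2 g) < e" by blast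
  qed
  then show "convergent X" by (auto simp: convergent_def)
qed

instance L2 :: banach ..

instance L2 :: second_countable_topology
proof
  define ind where "ind A = abs_L2 (indicator A)" for A :: "real set"
  define comb where "comb xs = (\<Sum>(c, a, b)\<leftarrow>xs. real_of_rat c *\<^sub>R ind {real_of_rat a<..<real_of_rat b})"
    for xs :: "(rat \<times> rat \<times> rat) list"
  define S where "S = closure (range comb)"
  have S_lim: "v \<in> S" if "\<And>n. w n \<in> S" "w \<longlonglongrightarrow> v" for w :: "nat \<Rightarrow> L2" and v
    using closed_sequentially[OF _ that(1) that(2)] by (simp add: S_def)
  have comb_add: "comb (xs @ ys) = comb xs + comb ys" for xs ys
    by (simp add: comb_def)
  have comb_range_add: "v + w \<in> range comb" if "v \<in> range comb" "w \<in> range comb" for v w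
    using that by (auto simp: comb_add[symmetric])
  have comb_scale: "comb (map (\<lambda>(c, a, b). (k * c, a, b)) xs) = real_of_rat k *\<^sub>R comb xs" for k xs
    by (induction xs) (auto simp: comb_def of_rat_mult scaleR_add_right)
  have S_comb: "comb xs \<in> S" for xs
    unfolding S_def by (rule subsetD[OF closure_subset rangeI])
  have S_iff: "v \<in> S \<longleftrightarrow> (\<exists>x. (\<forall>n. x n \<in> range comb) \<and> x \<longlonglongrightarrow> v)" for v
    unfolding S_def by (rule closure_sequential)
  have S_zero: "0 \<in> S" using S_comb[of "[]"] by (simp add: comb_def)
  have S_add: "v + w \<in> S" if v: "v \<in> S" and w: "w \<in> S" for v w
  proof -
    obtain x where x: "\<And>n. x n \<in> range comb" "x \<longlonglongrightarrow> v"
      using v unfolding S_iff by auto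
    obtain y where y: "\<And>n. y n \<in> range comb" "y \<longlonglongrightarrow> w"
      using w unfolding S_iff by auto
    show ?thesis
      unfolding S_iff
      by (intro exI[of _ "\<lambda>n. x n + y n"] conjI allI tendsto_add comb_range_add x y)
  qed
  have S_scale: "r *\<^sub>R v \<in> S" if v: "v \<in> S" for r v
  proof -
    obtain x where x: "\<And>n. x n \<in> range comb" "x \<longlonglongrightarrow> v"
      using v unfolding S_iff by auto
    have "\<exists>k. r < real_of_rat k \<and> real_of_rat k < r + inverse (real (Suc n))" for n
      by (rule of_rat_dense) simp
    then obtain k where k: "\<And>n. r < real_of_rat (k n)" "\<And>n. real_of_rat (k n) < r + inverse (real (Suc n))"
      by metis
    have "(\<lambda>n. real_of_rat (k n)) \<longlonglongrightarrow> r"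
    proof (rule tendsto_sandwich[of "\<lambda>n. r" _ _ "\<lambda>n. r + inverse (real (Suc n))"])
      show "(\<lambda>n. r + inverse (real (Suc n))) \<longlonglongrightarrow> r"
        using LIMSEQ_inverse_real_of_nat_add by simp
      show "(\<lambda>n. r) \<longlonglongrightarrow> r" by simp
    qed (intro always_eventually allI less_imp_le k)+
    then have "(\<lambda>n. real_of_rat (k n) *\<^sub>R x n) \<longlonglongrightarrow> r *\<^sub>R v"
      by (intro tendsto_scaleR x)
    moreover have "real_of_rat (k n) *\<^sub>R x n \<in> range comb" for n
      using x(1)[of n] by (auto simp: comb_scale[symmetric])
    ultimately show ?thesis
      unfolding S_iff by (intro exI conjI allI)
  qed
  have S_diff: "v - w \<in> S" if "v \<in> S" "w \<in> S" for v w
    using S_add[OF that(1) S_scale[OF that(2), of "-1"]] by simp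
  have sq_ind: "sq_integrable (indicator A)" if "A \<in> sets borel" for A
    by (rule sq_integrable_AE_bound[OF sq_integrable_const[of 1]])
      (use that in \<open>auto intro!: measurable_restrict_space1 measurable_completion split: split_indicator\<close>)
  have S_rat: "ind {real_of_rat a<..<real_of_rat b} \<in> S" for a b
    using S_comb[of "[(1, a, b)]"] by (simp add: comb_def)
  have ind_lim: "(\<lambda>n. ind (A n)) \<longlonglongrightarrow> ind B"
    if "\<And>n. A n \<in> sets borel" "B \<in> sets borel"
      "\<And>x. (\<lambda>n. indicator (A n) x :: real) \<longlonglongrightarrow> indicator B x" for A B
    unfolding ind_def
  proof (rule tendsto_abs_L2_dominated)
    show "sq_integrable (\<lambda>x. 1)" by (rule sq_integrable_const)
  qed (use that sq_ind in \<open>auto split: split_indicator\<close>)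
  have S_ivl: "ind {a<..<b} \<in> S" for a b :: real
  proof -
    have "\<exists>k. a < real_of_rat k \<and> real_of_rat k < a + inverse (real (Suc n))" for n
      by (rule of_rat_dense) simp
    then obtain k where k: "\<And>n. a < real_of_rat (k n)" "\<And>n. real_of_rat (k n) < a + inverse (real (Suc n))"
      by metis
    have "\<exists>k. b - inverse (real (Suc n)) < real_of_rat k \<and> real_of_rat k < b" for n
      by (rule of_rat_dense) simp
    then obtain l where l: "\<And>n. b - inverse (real (Suc n)) < real_of_rat (l n)" "\<And>n. real_of_rat (l n) < b"
      by metis
    have "(\<lambda>n. ind {real_of_rat (k n)<..<real_of_rat (l n)}) \<longlonglongrightarrow> ind {a<..<b}"
    proof (rule ind_lim)
      fix x
      show "(\<lambda>n. indicator {real_of_rat (k n)<..<real_of_rat (l n)} x :: real) \<longlonglongrightarrow> indicator {a<..<b} x"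
      proof (cases "x \<in> {a<..<b}")
        case True
        have 1: "(\<lambda>n. a + inverse (real (Suc n))) \<longlonglongrightarrow> a"
          using LIMSEQ_inverse_real_of_nat_add by simp
        have 2: "(\<lambda>n. b + - inverse (real (Suc n))) \<longlonglongrightarrow> b"
          using LIMSEQ_inverse_real_of_nat_add_minus by simp
        have e1: "\<forall>\<^sub>F n in sequentially. a + inverse (real (Suc n)) < x"
          using order_tendstoD(2)[OF 1, of x] True by simp
        have e2: "\<forall>\<^sub>F n in sequentially. x < b + - inverse (real (Suc n))"
          using order_tendstoD(1)[OF 2, of x] True by simp
        have "\<forall>\<^sub>F n in sequentially. indicator {real_of_rat (k n)<..<real_of_rat (l n)} x = (1::real)"
          using e1 e2
        proof eventually_elim
          case (elim n)
          then show ?case using k(2)[of n] l(1)[of n] by simp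
        qed
        then show ?thesis using True by (simp add: tendsto_eventually)
      next
        case False
        then have "x \<notin> {real_of_rat (k n)<..<real_of_rat (l n)}" for n
          using k(1)[of n] l(2)[of n] by auto
        then show ?thesis using False by simp
      qed
    qed auto
    then show ?thesis by (rule S_lim[rotated]) (rule S_rat)
  qed
  have S_one: "ind UNIV \<in> S"
  proof -
    have "ind UNIV = ind {0<..<1}"
      unfolding ind_def by (subst abs_L2_eq_iff) (auto intro!: sq_ind sq_integrable_const AE_I2 simp: space_restrict_space)
    then show ?thesis using S_ivl by simp
  qed
  have S_borel: "ind A \<in> S" if "A \<in> sets borel" for A
  proof -
    have eq: "sets borel = sigma_sets UNIV (range (\<lambda>(a, b). {a<..<b::real}))"
    proof -
      have "(\<lambda>(a, b). box a b :: real set) = (\<lambda>(a, b). {a<..<b})"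
        by (auto simp: fun_eq_iff)
      then show ?thesis by (simp add: borel_eq_box[where 'a=real] sets_measure_of)
    qed
    have "Int_stable (range (\<lambda>(a, b). {a<..<b::real}))"
    proof (rule Int_stableI, safe)
      fix a b a' b' :: real
      have "{a<..<b} \<inter> {a'<..<b'} = {max a a'<..<min b b'}" by auto
      then show "{a<..<b} \<inter> {a'<..<b'} \<in> range (\<lambda>(a, b). {a<..<b})" by auto
    qed
    moreover have "range (\<lambda>(a, b). {a<..<b::real}) \<subseteq> Pow UNIV" by auto
    moreover have "A \<in> sigma_sets UNIV (range (\<lambda>(a, b). {a<..<b::real}))"
      using that eq by simp
    ultimately show ?thesis
    proof (induction A rule: sigma_sets_induct_disjoint)
      case (basic A) then show ?case using S_ivl by auto
    next
      case empty
      have "ind {} = 0" unfolding ind_def zero_L2.abs_eq by (rule arg_cong[where f = abs_L2]) (auto simp: fun_eq_iff)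
      then show ?case using S_zero by simp
    next
      case (compl A)
      have "A \<in> sets borel" using compl eq by simp
      then have "ind (UNIV - A) = ind UNIV - ind A"
        unfolding ind_def by (subst minus_abs_L2) (auto intro!: sq_ind sq_integrable_const arg_cong[of _ _ abs_L2] split: split_indicator)
      then show ?case using S_diff[OF S_one] compl by simp
    next
      case (union A)
      have A: "A i \<in> sets borel" for i using union eq by auto
      have "ind (\<Union>i<n. A i) \<in> S" for n
      proof (induction n)
        case 0
        have "ind {} = 0" unfolding ind_def zero_L2.abs_eq by (rule arg_cong[where f = abs_L2]) (auto simp: fun_eq_iff)
        then show ?case using S_zero by simp
      next
        case (Suc n)
        have "A n \<inter> (\<Union>i<n. A i) = {}"
        proof -
          have "A n \<inter> A i = {}" if "i < n" for i
            using union(1) that by (simp add: disjoint_family_on_def)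
          then show ?thesis by auto
        qed
        then have "(\<lambda>x. indicator (A n) x + indicator (\<Union>i<n. A i) x :: real) = indicator (\<Union>i<Suc n. A i)"
          by (auto simp: fun_eq_iff lessThan_Suc indicator_def)
        then have "ind (\<Union>i<Suc n. A i) = ind (A n) + ind (\<Union>i<n. A i)"
          unfolding ind_def using A by (subst plus_abs_L2) (auto intro!: sq_ind)
        then show ?case using S_add union(3) Suc by simp
      qed
      moreover have "(\<lambda>n. ind (\<Union>i<n. A i)) \<longlonglongrightarrow> ind (\<Union>i. A i)"
        by (rule ind_lim) (use A in \<open>auto intro: LIMSEQ_indicator_UN\<close>)
      ultimately show ?case by (rule S_lim)
    qed
  qed
  have meas: "sq_integrable (indicator A) \<and> ind A \<in> S" if "A \<in> sets unit_meas" for A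
  proof -
    have A: "A \<in> sets lebesgue" using that by (simp add: sets_restrict_space_iff)
    have sq: "sq_integrable (indicator A)"
      by (rule sq_integrable_AE_bound[OF sq_integrable_const[of 1]])
        (use that in \<open>auto split: split_indicator\<close>)
    obtain T N N' where T: "A = T \<union> N" "N \<subseteq> N'" "N' \<in> null_sets lborel" "T \<in> sets lborel"
      using A by (rule sets_completionE)
    have "AE x in lebesgue. x \<notin> N'"
      using T(3) by (intro AE_completion AE_not_in)
    then have "AE x in unit_meas. indicator A x = (indicator T x :: real)"
      using T(1,2) by (subst AE_restrict_space_iff) (auto elim!: eventually_mono split: split_indicator)
    then have "ind A = ind T"
      unfolding ind_def using T(4) by (subst abs_L2_eq_iff) (auto intro: sq sq_ind)
    then show ?thesis using S_borel T(4) sq by simp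
  qed
  have S_all: "v \<in> S" for v
  proof -
    obtain f where f: "v = abs_L2 f" "sq_integrable f" by (rule L2_cases)
    then have "f \<in> borel_measurable unit_meas" by auto
    from borel_measurable_implies_sequence_metric[OF this, of 0] obtain s where s: "\<And>i. simple_function unit_meas (s i)"
      "\<And>x. x \<in> space unit_meas \<Longrightarrow> (\<lambda>i. s i x) \<longlonglongrightarrow> f x"
      "\<And>i x. x \<in> space unit_meas \<Longrightarrow> dist (s i x) 0 \<le> 2 * dist (f x) 0"
      by metis
    have simple: "abs_L2 h \<in> S" if h: "simple_function unit_meas h" for h
    proof -
      define Y where "Y y = h -` {y} \<inter> space unit_meas" for y
      have Y: "Y y \<in> sets unit_meas" for y
        unfolding Y_def using h by (rule simple_functionD(2))
      have fin: "finite (h ` space unit_meas)" using h by (rule simple_functionD)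
      have *: "sq_integrable (\<lambda>x. \<Sum>y\<in>F. y * indicator (Y y) x) \<and> abs_L2 (\<lambda>x. \<Sum>y\<in>F. y * indicator (Y y) x) \<in> S"
        if "finite F" for F
        using that
      proof induction
        case empty
        then show ?case using S_zero by (simp add: sq_integrable_const zero_L2.abs_eq)
      next
        case (insert y F)
        have y: "sq_integrable (\<lambda>x. y * indicator (Y y) x)"
          using meas[OF Y] by (intro sq_integrable_scale) simp
        have "abs_L2 (\<lambda>x. y * indicator (Y y) x) = y *\<^sub>R ind (Y y)"
          unfolding ind_def using meas[OF Y] by (subst scaleR_abs_L2) auto
        then have "abs_L2 (\<lambda>x. y * indicator (Y y) x) \<in> S"
          using S_scale meas[OF Y] by simp
        then have "abs_L2 (\<lambda>x. y * indicator (Y y) x) + abs_L2 (\<lambda>x. \<Sum>y\<in>F. y * indicator (Y y) x) \<in> S"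
          using insert.IH by (intro S_add) auto
        then show ?case
          unfolding sum.insert[OF insert(1,2)]
          using sq_integrable_add[OF y conjunct1[OF insert.IH]] plus_abs_L2[OF y conjunct1[OF insert.IH]]
          by (intro conjI) (simp_all only:)
      qed
      have "AE x in unit_meas. h x = (\<Sum>y\<in>h ` space unit_meas. y * indicator (Y y) x)"
      proof (rule AE_I2)
        fix x assume x: "x \<in> space unit_meas"
        have "(\<Sum>y\<in>h ` space unit_meas. y * indicator (Y y) x)
            = (\<Sum>y\<in>h ` space unit_meas. if h x = y then y else 0)"
          using x by (intro sum.cong) (auto simp: Y_def)
        also have "\<dots> = h x" using fin x by (subst sum.delta') auto
        finally show "h x = (\<Sum>y\<in>h ` space unit_meas. y * indicator (Y y) x)" by simp
      qed
      moreover from this have "sq_integrable h"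
        by (intro sq_integrable_AE_bound[OF conjunct1[OF *[OF fin]]] borel_measurable_simple_function h) auto
      ultimately have "abs_L2 h = abs_L2 (\<lambda>x. \<Sum>y\<in>h ` space unit_meas. y * indicator (Y y) x)"
        using *[OF fin] by (subst abs_L2_eq_iff) auto
      then show ?thesis using *[OF fin] by simp
    qed
    have "(\<lambda>i. abs_L2 (s i)) \<longlonglongrightarrow> abs_L2 f"
    proof (rule tendsto_abs_L2_dominated)
      show "sq_integrable (\<lambda>x. 2 * f x)" using f by (intro sq_integrable_scale)
      show "f \<in> borel_measurable unit_meas" using f by auto
      show "AE x in unit_meas. \<bar>s i x\<bar> \<le> \<bar>2 * f x\<bar>" for i
        using s(3)[of _ i] by (intro AE_I2) (simp add: abs_mult)
    qed (use s in \<open>auto intro: borel_measurable_simple_function\<close>)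
    then show ?thesis unfolding f by (rule S_lim[rotated]) (rule simple[OF s(1)])
  qed
  define B where "B = (\<lambda>(v, e). ball v (real_of_rat e)) ` (range comb \<times> UNIV)"
  have "topological_basis B"
  proof (rule topological_basisI)
    show "open U" if "U \<in> B" for U using that by (auto simp: B_def)
    fix U :: "L2 set" and v assume "open U" "v \<in> U"
    then obtain e where e: "e > 0" "ball v e \<subseteq> U" by (meson open_contains_ball)
    obtain k where k: "0 < real_of_rat k" "real_of_rat k < e / 2"
      using of_rat_dense[of 0 "e / 2"] e by auto
    obtain w where w: "w \<in> range comb" "dist w v < real_of_rat k"
      using S_all[of v] k(1) unfolding S_def closure_approachable by blast
    have "ball w (real_of_rat k) \<subseteq> ball v e"
    proof
      fix z assume "z \<in> ball w (real_of_rat k)"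
      then show "z \<in> ball v e"
        using w(2) k(2) dist_triangle[of v z w] by (simp add: dist_commute)
    qed
    then show "\<exists>W\<in>B. v \<in> W \<and> W \<subseteq> U"
      using w e by (intro bexI[of _ "ball w (real_of_rat k)"]) (auto simp: B_def)
  qed
  moreover have "countable B"
    unfolding B_def by (intro countable_image countable_SIGMA) auto
  ultimately show "\<exists>B::L2 set set. countable B \<and> open = generate_topology B"
    by (blast intro: topological_basis_imp_subbasis)
qed


text \<open>Test functions are the elements of \<open>C\<^sub>c\<^sup>\<infinity>(0,1)\<close>, extended by zero to the real line.\<close>

definition test_fun :: "(real \<Rightarrow> real) \<Rightarrow> bool" where
  "test_fun \<eta> \<longleftrightarrow> (\<forall>n x. (deriv ^^ n) \<eta> differentiable (at x)) \<and>
     (\<exists>a b. 0 < a \<and> b < 1 \<and> (\<forall>x. x \<notin> {a..b} \<longrightarrow> \<eta> x = 0))"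

definition has_weak_deriv :: "L2 \<Rightarrow> L2 \<Rightarrow> bool" where
  "has_weak_deriv v w \<longleftrightarrow>
     (\<forall>\<eta>. test_fun \<eta> \<longrightarrow> inner v (abs_L2 (deriv \<eta>)) = - inner w (abs_L2 \<eta>))"

definition weak_deriv :: "L2 \<Rightarrow> L2" where
  "weak_deriv v = (THE w. has_weak_deriv v w)"

definition H1 :: "L2 set" where
  "H1 = {v. \<exists>w. has_weak_deriv v w}"

definition H2 :: "L2 set" where
  "H2 = {v \<in> H1. weak_deriv v \<in> H1}"

definition H1_norm :: "L2 \<Rightarrow> real" where
  "H1_norm v = sqrt ((norm v)\<^sup>2 + (norm (weak_deriv v))\<^sup>2)"

definition H2_norm :: "L2 \<Rightarrow> real" where
  "H2_norm v = sqrt ((norm v)\<^sup>2 + (norm (weak_deriv v))\<^sup>2 + (norm (weak_deriv (weak_deriv v)))\<^sup>2)"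

text \<open>\<open>H\<^sub>0\<^sup>1(0,1)\<close> is the closure of the test functions in the norm of \<open>H\<^sup>1(0,1)\<close>.\<close>

definition H10 :: "L2 set" where
  "H10 = {v \<in> H1. \<forall>e>0. \<exists>\<eta>. test_fun \<eta> \<and> H1_norm (v - abs_L2 \<eta>) < e}"

definition dom_L :: "L2 set" where
  "dom_L = H2 \<inter> H10"

definition tendsto_dom_L :: "('a \<Rightarrow> L2) \<Rightarrow> L2 \<Rightarrow> 'a filter \<Rightarrow> bool" where
  "tendsto_dom_L u l F \<longleftrightarrow> l \<in> dom_L \<and> (\<forall>\<^sub>F t in F. u t \<in> dom_L) \<and> ((\<lambda>t. H2_norm (u t - l)) \<longlongrightarrow> 0) F"

definition continuous_on_dom_L :: "real set \<Rightarrow> (real \<Rightarrow> L2) \<Rightarrow> bool" where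
  "continuous_on_dom_L T u \<longleftrightarrow> (\<forall>t\<in>T. u t \<in> dom_L) \<and> (\<forall>t\<in>T. tendsto_dom_L u (u t) (at t within T))"

definition Linfty :: "(real \<Rightarrow> real) set" where
  "Linfty = {g \<in> borel_measurable unit_meas. \<exists>C. AE x in unit_meas. \<bar>g x\<bar> \<le> C}"

definition mult_L2 :: "(real \<Rightarrow> real) \<Rightarrow> L2 \<Rightarrow> L2" where
  "mult_L2 g v = abs_L2 (\<lambda>x. g x * rep_L2 v x)"

definition op_L :: "(real \<Rightarrow> real) \<Rightarrow> L2 \<Rightarrow> L2" where
  "op_L g v = weak_deriv (weak_deriv v) - mult_L2 g v"

definition eigenvalues_neg_L :: "(real \<Rightarrow> real) \<Rightarrow> real set" where
  "eigenvalues_neg_L g = {\<mu>. \<exists>\<omega>\<in>dom_L. \<omega> \<noteq> 0 \<and> - op_L g \<omega> = \<mu> *\<^sub>R \<omega>}"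

definition mittag_leffler :: "real \<Rightarrow> real \<Rightarrow> real \<Rightarrow> real" where
  "mittag_leffler \<alpha> \<beta> z = (\<Sum>n. z ^ n / Gamma (\<alpha> * real n + \<beta>))"

definition Delta :: "real \<Rightarrow> real \<Rightarrow> real \<Rightarrow> real \<Rightarrow> real" where
  "Delta \<alpha> p q \<mu> = mittag_leffler \<alpha> 1 (- \<mu> * q powr \<alpha>) - sqrt \<mu> * sin (sqrt \<mu> * p) - cos (sqrt \<mu> * p)"

text \<open>The time derivative is one-sided at \<open>-p\<close> and \<open>q\<close>, and at \<open>0\<close> it is the derivative from the left.\<close>

definition time_deriv :: "real \<Rightarrow> real \<Rightarrow> (real \<Rightarrow> L2) \<Rightarrow> real \<Rightarrow> L2" where
  "time_deriv p q u t =
     (if t \<le> 0 then vector_derivative u (at t within {-p..0}) else vector_derivative u (at t within {0..q}))"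

definition time_deriv2 :: "real \<Rightarrow> real \<Rightarrow> (real \<Rightarrow> L2) \<Rightarrow> real \<Rightarrow> L2" where
  "time_deriv2 p q u t = vector_derivative (time_deriv p q u) (at t)"

definition caputo_integrand :: "real \<Rightarrow> real \<Rightarrow> real \<Rightarrow> (real \<Rightarrow> L2) \<Rightarrow> real \<Rightarrow> real \<Rightarrow> L2" where
  "caputo_integrand \<alpha> p q u t s = (t - s) powr (- \<alpha>) *\<^sub>R time_deriv p q u s"

text \<open>The defining formula applies to \<open>t > 0\<close> only; the value at \<open>t = 0\<close>, needed to speak of continuity
  on the closed interval \<open>[0,q]\<close>, is the limit from the right.\<close>

definition caputo :: "real \<Rightarrow> real \<Rightarrow> real \<Rightarrow> (real \<Rightarrow> L2) \<Rightarrow> real \<Rightarrow> L2" where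
  "caputo \<alpha> p q u t =
     (let D = (\<lambda>t. if \<alpha> = 1 then time_deriv p q u t
                    else (1 / Gamma (1 - \<alpha>)) *\<^sub>R (LBINT s:{0<..<t}. caputo_integrand \<alpha> p q u t s))
      in if t = 0 then Lim (at_right 0) D else D t)"

definition solves_problem1 ::
  "real \<Rightarrow> real \<Rightarrow> real \<Rightarrow> (real \<Rightarrow> real) \<Rightarrow> L2 \<Rightarrow> L2 \<Rightarrow> (real \<Rightarrow> L2) \<Rightarrow> L2 \<Rightarrow> bool" where
  "solves_problem1 \<alpha> p q g \<phi> \<psi> u f \<longleftrightarrow>
     continuous_on_dom_L {-p..q} u \<and>
     (\<forall>t\<in>{-p..0}. u differentiable (at t within {-p..0})) \<and>
     (\<forall>t\<in>{0<..q}. u differentiable (at t within {0..q})) \<and>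
     continuous_on {-p..0} (time_deriv p q u) \<and>
     continuous_on {0<..q} (time_deriv p q u) \<and>
     (\<alpha> < 1 \<longrightarrow> (\<forall>t\<in>{0<..q}. set_integrable lborel {0<..<t} (caputo_integrand \<alpha> p q u t))) \<and>
     continuous_on {0..q} (caputo \<alpha> p q u) \<and>
     (\<forall>t\<in>{-p<..<0}. time_deriv p q u differentiable (at t)) \<and>
     continuous_on {-p<..<0} (time_deriv2 p q u) \<and>
     tendsto_dom_L u \<psi> (at_right (-p)) \<and>
     tendsto_dom_L u \<phi> (at_left q) \<and>
     (\<exists>l. (caputo \<alpha> p q u \<longlongrightarrow> l) (at_right 0) \<and> (time_deriv p q u \<longlongrightarrow> l) (at_left 0)) \<and>
     (\<forall>t\<in>{0..q}. \<forall>\<eta>\<in>dom_L.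
        inner (caputo \<alpha> p q u t) \<eta> - inner (op_L g (u t)) \<eta> = inner f \<eta>) \<and>
     (\<forall>t\<in>{-p<..<0}. \<forall>\<eta>\<in>dom_L.
        inner (time_deriv2 p q u t) \<eta> - inner (op_L g (u t)) \<eta> = inner f \<eta>)"

end

theory Submission
  imports Defs "HOL-Complex_Analysis.Great_Picard"
begin

text \<open>
  For an eigenfunction \<open>\<omega>\<close> of \<open>-L\<close> with eigenvalue \<open>\<mu>\<close> put \<open>S(t) = (u(t), \<omega>) - (f, \<omega>) / \<mu>\<close>. By symmetry of \<open>L\<close>,
  \<open>S'' = -\<mu> S\<close> for \<open>t < 0\<close>, the Caputo derivative of \<open>S\<close> is \<open>-\<mu> S\<close> for \<open>t > 0\<close>, and gluing gives
  \<open>S'(0-) = -\<mu> S(0)\<close>. Hence \<open>S(-p) = S(0) (cos (\<surd>\<mu> p) + \<surd>\<mu> sin (\<surd>\<mu> p))\<close> and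
  \<open>S(q) = S(0) E\<^bsub>\<alpha>,1\<^esub>(-\<mu> q\<^sup>\<alpha>)\<close>, so that \<open>(\<phi>, \<omega>) - (\<psi>, \<omega>) = S(0) \<Delta>\<close>: the data determine
  \<open>S(0)\<close>, then \<open>(f, \<omega>)\<close>, then \<open>(u(t), \<omega>)\<close> for all \<open>t\<close>. Uniqueness follows because the eigenfunctions are
  complete: \<open>-L\<close> has a compact symmetric inverse \<open>K\<close> on \<open>L\<^sup>2\<close> (energy minimisation and Arzela-Ascoli), and a
  nonzero \<open>K\<close>-invariant closed subspace orthogonal to all eigenfunctions would contain one of them.
\<close>

section \<open>Density of the test functions\<close>

text \<open>Two obstacles shape the proof. First, \<open>time_deriv\<close> may blow up as t tends
  to 0 from the right, so on that side a mode S is only known to be continuous at 0, and S' cannot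
  be prescribed there. The fractional equation is therefore turned into the Abel-Volterra equation
  S(t) = S(0) - \<mu> / Gamma(\<alpha>) times the integral of (t - s)^(\<alpha> - 1) S(s) over (0,
  t), which involves S alone. Iterating it produces the partial sums of the Mittag-Leffler series
  with an error that tends to 0, so the formula for S and the convergence of the series come
  together; \<alpha> = 1 is covered by the same equation. Second, elements of L2 have no point
  values: weak derivatives are unique because test functions separate L2, and the zero boundary
  values in \<open>H10\<close> are used only through limits of test functions. The Poincare
  inequality with constant 1 gives \<mu> \<ge> 1, which permits division by \<mu> and by its square
  root.\<close>

primrec times_differentiable :: "nat \<Rightarrow> (real \<Rightarrow> real) \<Rightarrow> bool" where
  "times_differentiable 0 f \<longleftrightarrow> (\<forall>x. f differentiable (at x))"
| "times_differentiable (Suc n) f \<longleftrightarrow> (\<forall>x. f differentiable (at x)) \<and> times_differentiable n (deriv f)"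

lemma times_differentiable_imp_differentiable:
  "times_differentiable n f \<Longrightarrow> f differentiable (at x)"
  by (cases n) auto

lemma times_differentiable_imp_DERIV:
  "times_differentiable n f \<Longrightarrow> DERIV f x :> deriv f x"
  using times_differentiable_imp_differentiable DERIV_deriv_iff_real_differentiable by blast

lemma times_differentiable_SucI:
  assumes "\<And>x. DERIV f x :> f' x" "times_differentiable n f'"
  shows "times_differentiable (Suc n) f"
proof -
  have "deriv f = f'" using assms(1) by (auto intro!: DERIV_imp_deriv)
  then show ?thesis using assms real_differentiable_def by auto
qed

lemma times_differentiable_Suc_imp: "times_differentiable (Suc n) f \<Longrightarrow> times_differentiable n f"
  by (induction n arbitrary: f) auto

text \<open>The recursion through \<open>deriv f\<close> suits induction over products and
  substitutions; this equivalence carries the results over to the iterates that define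
  \<open>test_fun\<close>. Order \<open>n\<close> grants \<open>n + 1\<close> derivatives, hence the
  bound k \<le> n in the proof.\<close>

lemma times_differentiable_deriv_funpow:
  "(\<forall>n x. (deriv ^^ n) f differentiable (at x)) \<longleftrightarrow> (\<forall>n. times_differentiable n f)"
proof -
  have "times_differentiable n f \<longleftrightarrow> (\<forall>k\<le>n. \<forall>x. (deriv ^^ k) f differentiable (at x))" for n
  proof (induction n arbitrary: f)
    case (Suc n)
    have "(\<forall>k\<le>Suc n. P k) \<longleftrightarrow> P 0 \<and> (\<forall>k\<le>n. P (Suc k))" for P
      by (metis Suc_le_mono le0 not0_implies_Suc)
    then show ?case using Suc by (simp add: funpow_Suc_right del: funpow.simps(2))
  qed auto
  then show ?thesis by auto
qed

lemma times_differentiable_add: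
  "times_differentiable n f \<Longrightarrow> times_differentiable n g \<Longrightarrow> times_differentiable n (\<lambda>x. f x + g x)"
proof (induction n arbitrary: f g)
  case (Suc n)
  show ?case
    by (rule times_differentiable_SucI[where f' = "\<lambda>x. deriv f x + deriv g x"])
      (use Suc in \<open>auto intro!: derivative_eq_intros times_differentiable_imp_DERIV[OF Suc.prems(1)]
        times_differentiable_imp_DERIV[OF Suc.prems(2)]\<close>)
qed auto

lemma times_differentiable_mult:
  "times_differentiable n f \<Longrightarrow> times_differentiable n g \<Longrightarrow> times_differentiable n (\<lambda>x. f x * g x)"
proof (induction n arbitrary: f g)
  case (Suc n)
  show ?case
  proof (rule times_differentiable_SucI[where f' = "\<lambda>x. deriv f x * g x + f x * deriv g x"])
    show "DERIV (\<lambda>x. f x * g x) x :> deriv f x * g x + f x * deriv g x" for x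
      by (auto intro!: derivative_eq_intros times_differentiable_imp_DERIV[OF Suc.prems(1)]
        times_differentiable_imp_DERIV[OF Suc.prems(2)])
    show "times_differentiable n (\<lambda>x. deriv f x * g x + f x * deriv g x)"
      using Suc.prems times_differentiable_Suc_imp
      by (intro times_differentiable_add Suc.IH) auto
  qed
qed auto

lemma times_differentiable_const: "times_differentiable n (\<lambda>x. c)"
proof (induction n arbitrary: c)
  case (Suc n)
  show ?case by (rule times_differentiable_SucI[where f' = "\<lambda>x. 0"]) (auto intro: Suc)
qed auto

lemma times_differentiable_cmult: "times_differentiable n f \<Longrightarrow> times_differentiable n (\<lambda>x. c * f x)"
  by (rule times_differentiable_mult[OF times_differentiable_const])

lemma times_differentiable_affine:
  "times_differentiable n f \<Longrightarrow> times_differentiable n (\<lambda>x. f (m * x + c))"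
proof (induction n arbitrary: f)
  case 0
  show ?case
    unfolding times_differentiable.simps
  proof
    fix x
    have "DERIV (\<lambda>x. f (m * x + c)) x :> deriv f (m * x + c) * m"
      by (rule DERIV_chain2[OF times_differentiable_imp_DERIV[OF 0]]) (auto intro!: derivative_eq_intros)
    then show "(\<lambda>x. f (m * x + c)) differentiable (at x)" using real_differentiable_def by auto
  qed
next
  case (Suc n)
  show ?case
  proof (rule times_differentiable_SucI[where f' = "\<lambda>x. m * deriv f (m * x + c)"])
    fix x
    have "DERIV (\<lambda>x. f (m * x + c)) x :> deriv f (m * x + c) * m"
      by (rule DERIV_chain2[OF times_differentiable_imp_DERIV[OF Suc.prems]]) (auto intro!: derivative_eq_intros)
    then show "DERIV (\<lambda>x. f (m * x + c)) x :> m * deriv f (m * x + c)" by (simp only: mult.commute)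
  next
    show "times_differentiable n (\<lambda>x. m * deriv f (m * x + c))"
      using Suc by (intro times_differentiable_cmult) auto
  qed
qed

text \<open>The classical flat function x^(-k) exp(-1/x). The exponent \<open>k\<close> makes the
  family closed under differentiation up to linear combinations, so a single induction proves
  smoothness of all members.\<close>

definition flat_exp :: "nat \<Rightarrow> real \<Rightarrow> real" where
  "flat_exp k x = (if x > 0 then (1 / x) ^ k * exp (- (1 / x)) else 0)"

lemma DERIV_flat_exp: "DERIV (flat_exp k) x :> flat_exp (k + 2) x - real k * flat_exp (k + 1) x"
proof -
  consider "x < 0" | "x > 0" | "x = 0" by linarith
  then show ?thesis
  proof cases
    case 1
    have "DERIV (\<lambda>x. 0) x :> (0 :: real)" by simp
    then have "DERIV (flat_exp k) x :> 0"
      by (rule has_field_derivative_transform_within_open[where S = "{..<0}"])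
        (use 1 in \<open>auto simp: flat_exp_def\<close>)
    then show ?thesis using 1 by (simp add: flat_exp_def)
  next
    case 2
    have "DERIV (\<lambda>x. (1 / x) ^ k * exp (- (1 / x))) x :> flat_exp (k + 2) x - real k * flat_exp (k + 1) x"
    proof -
      have d1: "DERIV (\<lambda>x. 1 / x) x :> - ((1 / x)\<^sup>2)"
        using 2 by (auto intro!: derivative_eq_intros simp: power2_eq_square)
      have d2: "DERIV (\<lambda>x. exp (- (1 / x))) x :> exp (- (1 / x)) * (1 / x)\<^sup>2"
        using DERIV_chain2[OF DERIV_exp DERIV_minus[OF d1]] by simp
      show ?thesis
        by (rule DERIV_cong[OF DERIV_mult[OF DERIV_power[OF d1] d2]])
          (use 2 in \<open>cases k; simp add: flat_exp_def algebra_simps power2_eq_square\<close>)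
    qed
    then show ?thesis
      by (rule has_field_derivative_transform_within_open[where S = "{0<..}"])
        (use 2 in \<open>auto simp: flat_exp_def\<close>)
  next
    case 3
    \<comment> \<open>The difference quotient of \<open>flat_exp k\<close> at 0 is
      \<open>flat_exp (Suc k)\<close>, so the derivative at 0 is the limit of that function.\<close>
    have "((\<lambda>h. flat_exp (Suc k) h) \<longlongrightarrow> 0) (at_left 0)"
      by (rule tendsto_eventually) (auto simp: flat_exp_def eventually_at_filter)
    moreover have "((\<lambda>h. flat_exp (Suc k) h) \<longlongrightarrow> 0) (at_right 0)"
    proof -
      have "((\<lambda>h. inverse h ^ Suc k / exp (inverse h)) \<longlongrightarrow> (0::real)) (at_right 0)"
        by (rule filterlim_compose[OF tendsto_power_div_exp_0 filterlim_inverse_at_top_right])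
      then show ?thesis
        by (rule Lim_transform_eventually)
          (auto simp: flat_exp_def eventually_at_filter exp_minus field_simps)
    qed
    ultimately have "((\<lambda>h. flat_exp (Suc k) h) \<longlongrightarrow> 0) (at 0)"
      by (simp add: filterlim_split_at)
    then have "((\<lambda>h. (flat_exp k (0 + h) - flat_exp k 0) / h) \<longlongrightarrow> 0) (at 0)"
      by (rule Lim_transform_eventually) (auto simp: flat_exp_def eventually_at_filter)
    then show ?thesis using 3 by (simp add: DERIV_def flat_exp_def)
  qed
qed

lemma times_differentiable_flat_exp: "times_differentiable n (flat_exp k)"
proof (induction n arbitrary: k)
  case 0
  show ?case using DERIV_flat_exp real_differentiable_def by auto
next
  case (Suc n)
  show ?case
  proof (rule times_differentiable_SucI[OF DERIV_flat_exp])
    have "times_differentiable n (\<lambda>x. flat_exp (k + 2) x + (- real k) * flat_exp (k + 1) x)"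
      by (intro times_differentiable_add times_differentiable_cmult Suc)
    then show "times_differentiable n (\<lambda>x. flat_exp (k + 2) x - real k * flat_exp (k + 1) x)" by simp
  qed
qed

text \<open>Stretching by \<open>Suc n\<close> drives each factor to 1 wherever its argument is
  positive, so these functions fill up the indicator of the open interval while vanishing outside
  it. All values lie between 0 and 1, which makes the constant 1 a dominating function.\<close>

definition bump :: "real \<Rightarrow> real \<Rightarrow> nat \<Rightarrow> real \<Rightarrow> real" where
  "bump a b n x = flat_exp 0 (real (Suc n) * (x - a)) * flat_exp 0 (real (Suc n) * (b - x))"

lemma test_fun_bump:
  assumes "0 < a" "b < 1"
  shows "test_fun (bump a b n)"
proof -
  have "times_differentiable k (bump a b n)" for k
  proof -
    have "times_differentiable k (\<lambda>x. flat_exp 0 (real (Suc n) * x + (- real (Suc n) * a))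
        * flat_exp 0 ((- real (Suc n)) * x + real (Suc n) * b))"
      by (intro times_differentiable_mult times_differentiable_affine times_differentiable_flat_exp)
    also have "(\<lambda>x. flat_exp 0 (real (Suc n) * x + (- real (Suc n) * a))
        * flat_exp 0 ((- real (Suc n)) * x + real (Suc n) * b)) = bump a b n"
      by (auto simp: bump_def fun_eq_iff algebra_simps)
    finally show ?thesis .
  qed
  moreover have "bump a b n x = 0" if "x \<notin> {a..b}" for x
    using that by (auto simp: bump_def flat_exp_def zero_less_mult_iff not_le)
  ultimately show ?thesis
    using assms unfolding test_fun_def times_differentiable_deriv_funpow by blast
qed

lemma bump_bounds: "\<bar>bump a b n x\<bar> \<le> 1"
proof -
  have "0 \<le> flat_exp 0 x \<and> flat_exp 0 x \<le> 1" for x by (auto simp: flat_exp_def)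
  then show ?thesis by (auto simp: bump_def abs_mult intro!: mult_le_one)
qed

lemma bump_tendsto: "(\<lambda>n. bump a b n x) \<longlonglongrightarrow> indicator {a<..<b} x"
proof (cases "x \<in> {a<..<b}")
  case True
  have "(\<lambda>n. exp (- (inverse (real (Suc n)) * (1 / y)))) \<longlonglongrightarrow> exp (- (0 * (1 / y)))" for y :: real
    by (intro tendsto_intros LIMSEQ_inverse_real_of_nat)
  then have "(\<lambda>n. flat_exp 0 (real (Suc n) * y)) \<longlonglongrightarrow> 1" if "y > 0" for y
    using that by (simp add: flat_exp_def field_simps del: of_nat_Suc)
  from tendsto_mult[OF this this, of "x - a" "b - x"] show ?thesis
    using True by (simp add: bump_def del: of_nat_Suc)
next
  case False
  then have "bump a b n x = 0" for n
    by (auto simp: bump_def flat_exp_def zero_less_mult_iff)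
  then show ?thesis using False by simp
qed

section \<open>Integration over the unit interval\<close>

lemma sq_integrable_indicator_mult:
  assumes "sq_integrable f" "A \<in> sets unit_meas"
  shows "sq_integrable (\<lambda>x. f x * indicator A x)"
  by (rule sq_integrable_AE_bound[OF assms(1)]) (use assms in \<open>auto split: split_indicator\<close>)

lemma borel_measurable_unit:
  fixes f :: "real \<Rightarrow> real"
  assumes "f \<in> borel_measurable borel" shows "f \<in> borel_measurable unit_meas"
  using assms by (simp add: measurable_completion measurable_restrict_space1)

lemma borel_measurable_unit_indicator: "A \<in> sets borel \<Longrightarrow> indicat_real A \<in> borel_measurable unit_meas"
  by (rule borel_measurable_unit) simp

lemma sq_integrable_indicator: "A \<in> sets borel \<Longrightarrow> sq_integrable (indicator A)"
  by (rule sq_integrable_AE_bound[OF sq_integrable_const[of 1] borel_measurable_unit_indicator])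
    (auto split: split_indicator)

lemma sq_integrable_continuous:
  assumes "continuous_on UNIV f" shows "sq_integrable f"
proof -
  have "bounded (f ` {0..1})"
    by (intro compact_imp_bounded compact_continuous_image continuous_on_subset[OF assms]) auto
  then obtain M where M: "\<And>x. x \<in> {0..1} \<Longrightarrow> \<bar>f x\<bar> \<le> M"
    unfolding bounded_iff by fastforce
  have "M \<ge> 0" using M[of 0] by auto
  show ?thesis
  proof (rule sq_integrable_AE_bound[OF sq_integrable_const[of M]])
    show "f \<in> borel_measurable unit_meas"
      using assms by (intro borel_measurable_unit borel_measurable_continuous_onI)
    show "AE x in unit_meas. \<bar>f x\<bar> \<le> \<bar>M\<bar>"
      using M \<open>M \<ge> 0\<close> by (intro AE_I2) auto
  qed
qed

lemma LINT_indicator_derivative: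
  assumes D: "\<And>x. DERIV F x :> f x" and f: "continuous_on UNIV f" and ab: "0 \<le> a" "a \<le> b" "b \<le> 1"
  shows "(LINT x|unit_meas. f x * indicator {a..b} x) = F b - F a"
proof -
  have "{a..b} \<inter> {0<..<1} \<in> sets unit_meas" by (simp add: sets_restrict_space_iff)
  then have "sq_integrable (\<lambda>x. f x * indicator ({a..b} \<inter> {0<..<1}) x)"
    by (intro sq_integrable_indicator_mult sq_integrable_continuous f)
  then have "integrable unit_meas (\<lambda>x. f x * indicator ({a..b} \<inter> {0<..<1}) x)"
    by (rule sq_integrable_integrable)
  also have "?this \<longleftrightarrow> integrable unit_meas (\<lambda>x. f x * indicator {a..b} x)"
    by (intro Bochner_Integration.integrable_cong) (auto split: split_indicator)
  finally have "(LINT x|unit_meas. f x * indicator {a..b} x) = integral {0<..<1} (\<lambda>x. f x * indicator {a..b} x)"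
    by (intro lebesgue_integral_eq_integral) auto
  also have "\<dots> = F b - F a"
  proof (rule integral_unique)
    have "(f has_integral (F b - F a)) {a..b}"
      using ab D by (intro fundamental_theorem_of_calculus)
        (auto simp: has_real_derivative_iff_has_vector_derivative[symmetric] intro: has_field_derivative_at_within)
    then have "((\<lambda>x. if x \<in> {a..b} then f x else 0) has_integral (F b - F a)) {0..1}"
      using ab by (subst has_integral_restrict) auto
    also have "(\<lambda>x. if x \<in> {a..b} then f x else 0) = (\<lambda>x. f x * indicator {a..b} x)"
      by (auto simp: fun_eq_iff)
    finally show "((\<lambda>x. f x * indicator {a..b} x) has_integral (F b - F a)) {0<..<1}"
      by (simp only: has_integral_Icc_iff_Ioo)
  qed
  finally show ?thesis .
qed

lemma LINT_derivative:
  assumes "\<And>x. DERIV F x :> f x" and "continuous_on UNIV f"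
  shows "(LINT x|unit_meas. f x) = F 1 - F 0"
proof -
  have "(LINT x|unit_meas. f x) = (LINT x|unit_meas. f x * indicator {0..1} x)"
    by (intro Bochner_Integration.integral_cong) auto
  then show ?thesis using LINT_indicator_derivative[OF assms, of 0 1] by simp
qed

text \<open>Bounded pointwise limits carry orthogonality from bumps to indicators of intervals, a
  Dynkin-system argument carries it to Borel sets, and a function with zero integral over every
  measurable set vanishes almost everywhere. This gives the uniqueness on which the definite
  description in \<open>weak_deriv\<close> depends.\<close>

lemma L2_eq_zero_if_orthogonal_tests:
  assumes orth: "\<And>\<eta>. test_fun \<eta> \<Longrightarrow> inner w (abs_L2 \<eta>) = 0"
  shows "w = 0"
proof -
  define ind where "ind A = abs_L2 (indicator A)" for A :: "real set"
  have lim: "inner w (abs_L2 f) = 0"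
    if "\<And>n. s n \<in> borel_measurable borel" "f \<in> borel_measurable borel" "\<And>n x. \<bar>s n x\<bar> \<le> 1" "\<And>x. \<bar>f x\<bar> \<le> 1"
      "\<And>x. x \<in> {0<..<1} \<Longrightarrow> (\<lambda>n. s n x) \<longlonglongrightarrow> f x" "\<And>n. inner w (abs_L2 (s n)) = 0"
    for s :: "nat \<Rightarrow> real \<Rightarrow> real" and f
  proof -
    have "(\<lambda>n. abs_L2 (s n)) \<longlonglongrightarrow> abs_L2 f"
    proof (rule tendsto_abs_L2_dominated[OF _ _ sq_integrable_const[of 1]])
      show "AE x in unit_meas. (\<lambda>n. s n x) \<longlonglongrightarrow> f x"
        by (rule AE_I2) (use that(5) in simp)
      show "AE x in unit_meas. \<bar>s n x\<bar> \<le> \<bar>1\<bar>" for n by (rule AE_I2) (use that(3) in simp)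
      show "AE x in unit_meas. \<bar>f x\<bar> \<le> \<bar>1\<bar>" by (rule AE_I2) (use that(4) in simp)
    qed (use that(1,2) in \<open>auto intro: borel_measurable_unit\<close>)
    from tendsto_inner[OF tendsto_const this, of w] show ?thesis
      using that(6) by (simp add: LIMSEQ_const_iff)
  qed
  have bump_meas: "bump a b n \<in> borel_measurable borel" for a b n
  proof -
    have "continuous_on UNIV (flat_exp 0)"
      by (rule DERIV_continuous_on) (rule has_field_derivative_at_within, rule DERIV_flat_exp)
    then have [measurable]: "flat_exp 0 \<in> borel_measurable borel" by (rule borel_measurable_continuous_onI)
    show ?thesis unfolding bump_def[abs_def] by measurable
  qed
  have ivl01: "inner w (ind {a<..<b}) = 0" if "0 < a" "b < 1" for a b
    unfolding ind_def
    by (rule lim[where s = "bump a b", OF bump_meas _ bump_bounds _ bump_tendsto orth[OF test_fun_bump[OF that]]])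
      (auto split: split_indicator)
  \<comment> \<open>Bumps need endpoints strictly inside the unit interval, so an arbitrary interval
    is first cut down to (e n, 1 - e n); a point of (0, 1) notices the cut for finitely many n
    only.\<close>
  have ivl: "inner w (ind {a<..<b}) = 0" for a b
    unfolding ind_def
  proof (rule lim)
    define e where "e n = inverse (real (Suc n))" for n
    have e: "e \<longlonglongrightarrow> 0" "\<And>n. e n > 0" unfolding e_def using LIMSEQ_inverse_real_of_nat by auto
    show "inner w (abs_L2 (indicator {max a (e n)<..<min b (1 - e n)})) = 0" for n
      using ivl01[of "max a (e n)" "min b (1 - e n)"] e(2)[of n] by (simp add: ind_def)
    show "(\<lambda>n. indicator {max a (e n)<..<min b (1 - e n)} x :: real) \<longlonglongrightarrow> indicator {a<..<b} x"
      if x: "x \<in> {0<..<1}" for x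
    proof (rule tendsto_eventually)
      have "\<forall>\<^sub>F n in sequentially. e n < min x (1 - x)"
        using order_tendstoD(2)[OF e(1), of "min x (1 - x)"] x by simp
      then show "\<forall>\<^sub>F n in sequentially. indicator {max a (e n)<..<min b (1 - e n)} x = (indicator {a<..<b} x :: real)"
        by eventually_elim (auto simp: indicator_def)
    qed
  qed (auto split: split_indicator)
  \<comment> \<open>Complements will be taken in the whole line, while only (0, 1) is an interval
    already treated; in \<open>L2\<close> the two indicators coincide.\<close>
  have ind_UNIV: "ind UNIV = ind {0<..<1}"
    unfolding ind_def by (subst abs_L2_eq_iff) (auto intro!: sq_integrable_indicator sq_integrable_const)
  have borel: "inner w (ind A) = 0" if "A \<in> sets borel" for A
  proof -
    have eq: "sets borel = sigma_sets UNIV (range (\<lambda>(a, b). {a<..<b::real}))"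
    proof -
      have "(\<lambda>(a, b). box a b :: real set) = (\<lambda>(a, b). {a<..<b})"
        by (auto simp: fun_eq_iff)
      then show ?thesis by (simp add: borel_eq_box[where 'a=real] sets_measure_of)
    qed
    have "Int_stable (range (\<lambda>(a, b). {a<..<b::real}))"
    proof (rule Int_stableI, safe)
      fix a b a' b' :: real
      have "{a<..<b} \<inter> {a'<..<b'} = {max a a'<..<min b b'}" by auto
      then show "{a<..<b} \<inter> {a'<..<b'} \<in> range (\<lambda>(a, b). {a<..<b})" by auto
    qed
    moreover have "range (\<lambda>(a, b). {a<..<b::real}) \<subseteq> Pow UNIV" by auto
    moreover have "A \<in> sigma_sets UNIV (range (\<lambda>(a, b). {a<..<b::real}))"
      using that eq by simp
    ultimately show ?thesis
    proof (induction A rule: sigma_sets_induct_disjoint)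
      case (basic A) then show ?case using ivl by auto
    next
      case empty
      then show ?case using ivl[of 0 0] by simp
    next
      case (compl A)
      have "A \<in> sets borel" using compl eq by simp
      then have "ind (UNIV - A) = ind UNIV - ind A"
        unfolding ind_def
        by (subst minus_abs_L2) (auto intro!: sq_integrable_indicator sq_integrable_const arg_cong[of _ _ abs_L2] split: split_indicator)
      then show ?case using compl ivl[of 0 1] by (simp add: ind_UNIV inner_diff_right)
    next
      case (union A)
      have A: "A i \<in> sets borel" for i using union eq by auto
      have part: "inner w (ind (\<Union>i<n. A i)) = 0" for n
      proof (induction n)
        case 0
        then show ?case using ivl[of 0 0] by simp
      next
        case (Suc n)
        have "A n \<inter> A i = {}" if "i < n" for i
          using union(1) that by (simp add: disjoint_family_on_def)
        then have "A n \<inter> (\<Union>i<n. A i) = {}" by auto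
        then have "(\<lambda>x. indicator (A n) x + indicator (\<Union>i<n. A i) x :: real) = indicator (\<Union>i<Suc n. A i)"
          by (auto simp: fun_eq_iff lessThan_Suc indicator_def)
        then have "ind (\<Union>i<Suc n. A i) = ind (A n) + ind (\<Union>i<n. A i)"
          unfolding ind_def using A by (subst plus_abs_L2) (auto intro!: sq_integrable_indicator)
        then show ?case using union(3) Suc by (simp add: inner_add_right)
      qed
      show ?case
        unfolding ind_def
        by (rule lim[where s = "\<lambda>n. indicator (\<Union>i<n. A i)", OF _ _ _ _ LIMSEQ_indicator_UN])
          (use A part in \<open>auto simp: ind_def split: split_indicator\<close>)
    qed
  qed
  have "AE x in unit_meas. rep_L2 w x = 0"
  proof (rule sigma_finite_measure.density_zero[OF finite_measure.axioms(1)[OF finite_measure_unit]])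
    show "integrable unit_meas (rep_L2 w)" by (rule sq_integrable_integrable) simp
    \<comment> \<open>A Lebesgue set differs from a Borel set \<open>T\<close> by a null set, which
      the integral does not see.\<close>
    fix A assume A: "A \<in> sets unit_meas"
    then have "A \<in> sets lebesgue" by (simp add: sets_restrict_space_iff)
    then obtain T N N' where T: "A = T \<union> N" "N \<subseteq> N'" "N' \<in> null_sets lborel" "T \<in> sets lborel"
      by (rule sets_completionE)
    have "AE x in lebesgue. x \<notin> N'"
      using T(3) by (intro AE_completion AE_not_in)
    then have AE: "AE x in unit_meas. indicator A x = (indicator T x :: real)"
      using T(1,2) by (subst AE_restrict_space_iff) (auto elim!: eventually_mono split: split_indicator)
    have "(LINT x|unit_meas. indicator A x *\<^sub>R rep_L2 w x) = (LINT x|unit_meas. rep_L2 w x * indicator T x)"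
      by (intro integral_cong_AE)
        (use A T(4) sq_integrableD(1)[OF sq_integrable_rep, of w] AE in
          \<open>auto intro!: borel_measurable_times borel_measurable_unit_indicator\<close>)
    also have "\<dots> = inner w (ind T)"
      using inner_abs_L2[OF sq_integrable_rep sq_integrable_indicator, of T w] T(4) by (simp add: ind_def)
    finally show "set_lebesgue_integral unit_meas A (rep_L2 w) = 0"
      using borel T(4) by (simp add: set_lebesgue_integral_def)
  qed
  then have "abs_L2 (rep_L2 w) = abs_L2 (\<lambda>x. 0)"
    by (subst abs_L2_eq_iff) (auto intro: sq_integrable_const)
  then show ?thesis by (simp add: zero_L2.abs_eq)
qed

section \<open>Weak derivatives and \<open>H\<^sub>0\<^sup>1\<close>\<close>

lemma test_fun_DERIV: "test_fun \<eta> \<Longrightarrow> DERIV \<eta> x :> deriv \<eta> x"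
  unfolding test_fun_def times_differentiable_deriv_funpow
  using times_differentiable_imp_DERIV by blast

lemma test_fun_DERIV2: "test_fun \<eta> \<Longrightarrow> DERIV (deriv \<eta>) x :> deriv (deriv \<eta>) x"
  unfolding test_fun_def times_differentiable_deriv_funpow
  using times_differentiable_imp_DERIV times_differentiable.simps(2) by blast

lemma test_fun_continuous:
  assumes "test_fun \<eta>"
  shows "continuous_on UNIV \<eta>" "continuous_on UNIV (deriv \<eta>)"
  by (rule DERIV_continuous_on, rule has_field_derivative_at_within, rule test_fun_DERIV[OF assms])
    (rule DERIV_continuous_on, rule has_field_derivative_at_within, rule test_fun_DERIV2[OF assms])

lemma test_fun_sq_integrable:
  assumes "test_fun \<eta>"
  shows "sq_integrable \<eta>" "sq_integrable (deriv \<eta>)"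
  using test_fun_continuous[OF assms] by (auto intro: sq_integrable_continuous)

lemma test_fun_boundary: "test_fun \<eta> \<Longrightarrow> \<eta> 0 = 0" "test_fun \<eta> \<Longrightarrow> \<eta> 1 = 0"
  by (auto simp: test_fun_def)

lemma test_fun_lincomb:
  assumes "test_fun \<eta>" "test_fun \<zeta>"
  shows "test_fun (\<lambda>x. \<eta> x + c * \<zeta> x)"
proof -
  obtain a b where ab: "0 < a" "b < 1" "\<And>x. x \<notin> {a..b} \<Longrightarrow> \<eta> x = 0"
    using assms(1) unfolding test_fun_def by blast
  obtain a' b' where ab': "0 < a'" "b' < 1" "\<And>x. x \<notin> {a'..b'} \<Longrightarrow> \<zeta> x = 0"
    using assms(2) unfolding test_fun_def by blast
  have "\<eta> x + c * \<zeta> x = 0" if "x \<notin> {min a a'..max b b'}" for x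
  proof -
    have "x \<notin> {a..b}" "x \<notin> {a'..b'}" using that by auto
    then show ?thesis using ab(3) ab'(3) by simp
  qed
  moreover have "0 < min a a'" "max b b' < 1" using ab ab' by auto
  moreover have "\<forall>n x. (deriv ^^ n) (\<lambda>x. \<eta> x + c * \<zeta> x) differentiable (at x)"
    using assms unfolding test_fun_def times_differentiable_deriv_funpow
    using times_differentiable_add[OF _ times_differentiable_cmult] by blast
  ultimately show ?thesis unfolding test_fun_def by blast
qed

lemma deriv_lincomb:
  assumes "test_fun \<eta>" "test_fun \<zeta>"
  shows "deriv (\<lambda>x. \<eta> x + c * \<zeta> x) = (\<lambda>x. deriv \<eta> x + c * deriv \<zeta> x)"
  by (rule ext, rule DERIV_imp_deriv)
    (auto intro!: derivative_eq_intros test_fun_DERIV[OF assms(1)] test_fun_DERIV[OF assms(2)])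

lemma abs_L2_lincomb:
  assumes "sq_integrable f" "sq_integrable h"
  shows "abs_L2 (\<lambda>x. f x + c * h x) = abs_L2 f + c *\<^sub>R abs_L2 h"
  by (simp add: scaleR_abs_L2 plus_abs_L2 assms sq_integrable_scale)

lemma has_weak_deriv_test:
  assumes "test_fun \<eta>"
  shows "has_weak_deriv (abs_L2 \<eta>) (abs_L2 (deriv \<eta>))"
  unfolding has_weak_deriv_def
proof safe
  fix \<zeta> assume z: "test_fun \<zeta>"
  have 1: "integrable unit_meas (\<lambda>x. \<eta> x * deriv \<zeta> x)" "integrable unit_meas (\<lambda>x. deriv \<eta> x * \<zeta> x)"
    by (intro integrable_mult_sq test_fun_sq_integrable assms z)+
  have "(LINT x|unit_meas. \<eta> x * deriv \<zeta> x + deriv \<eta> x * \<zeta> x) = \<eta> 1 * \<zeta> 1 - \<eta> 0 * \<zeta> 0"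
  proof (rule LINT_derivative)
    show "DERIV (\<lambda>x. \<eta> x * \<zeta> x) x :> \<eta> x * deriv \<zeta> x + deriv \<eta> x * \<zeta> x" for x
      by (auto intro!: derivative_eq_intros test_fun_DERIV[OF assms] test_fun_DERIV[OF z])
    show "continuous_on UNIV (\<lambda>x. \<eta> x * deriv \<zeta> x + deriv \<eta> x * \<zeta> x)"
      by (intro continuous_intros test_fun_continuous assms z)
  qed
  also have "\<dots> = 0" by (simp add: test_fun_boundary[OF z])
  finally show "inner (abs_L2 \<eta>) (abs_L2 (deriv \<zeta>)) = - inner (abs_L2 (deriv \<eta>)) (abs_L2 \<zeta>)"
    using 1 by (simp add: inner_abs_L2 test_fun_sq_integrable assms z)
qed

lemma weak_deriv_eq:
  assumes "has_weak_deriv v w"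
  shows "weak_deriv v = w"
  unfolding weak_deriv_def
proof (rule the_equality[where P = "has_weak_deriv v", OF assms])
  fix w' assume "has_weak_deriv v w'"
  then have "w' - w = 0"
    using assms by (intro L2_eq_zero_if_orthogonal_tests) (auto simp: has_weak_deriv_def inner_diff_left)
  then show "w' = w" by simp
qed

lemma H1_iff: "v \<in> H1 \<longleftrightarrow> has_weak_deriv v (weak_deriv v)"
  unfolding H1_def using weak_deriv_eq by auto

lemma has_weak_deriv_diff:
  "has_weak_deriv v w \<Longrightarrow> has_weak_deriv v' w' \<Longrightarrow> has_weak_deriv (v - v') (w - w')"
  by (auto simp: has_weak_deriv_def inner_diff_left)

text \<open>The graph of the weak derivative on \<open>H\<^sub>0\<^sup>1\<close>; being a closure, it inherits every closed condition
  from test functions.\<close>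

definition H10_graph :: "(L2 \<times> L2) set" where
  "H10_graph = closure {(abs_L2 \<eta>, abs_L2 (deriv \<eta>)) | \<eta>. test_fun \<eta>}"

lemma H10_graph_test: "test_fun \<eta> \<Longrightarrow> (abs_L2 \<eta>, abs_L2 (deriv \<eta>)) \<in> H10_graph"
  unfolding H10_graph_def by (rule set_mp[OF closure_subset]) auto

lemma H10_graph_induct [consumes 1, case_names closed test]:
  assumes "(v, w) \<in> H10_graph" "closed {(v, w). P v w}"
    "\<And>\<eta>. test_fun \<eta> \<Longrightarrow> P (abs_L2 \<eta>) (abs_L2 (deriv \<eta>))"
  shows "P v w"
proof -
  have "H10_graph \<subseteq> {(v, w). P v w}"
    unfolding H10_graph_def using assms(2,3) by (intro closure_minimal) auto
  then show ?thesis using assms(1) by auto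
qed

text \<open>For a test function this is the definition of \<open>has_weak_deriv y z\<close>, and
  both sides are continuous in \<open>(v, w)\<close>. The zero boundary values sit in
  \<open>v\<close> alone, so \<open>y\<close> may itself be a derivative; this is how
  \<open>op_L\<close> acquires its symmetric form.\<close>

lemma H10_graph_by_parts:
  assumes "(v, w) \<in> H10_graph" "has_weak_deriv y z"
  shows "inner y w = - inner z v"
  using assms(1)
proof (induction rule: H10_graph_induct)
  case closed
  show ?case
    unfolding case_prod_unfold by (intro closed_Collect_eq continuous_intros)
next
  case (test \<eta>)
  then show ?case using assms(2) by (simp add: has_weak_deriv_def)
qed

lemma H10_graph_has_weak_deriv:
  assumes "(v, w) \<in> H10_graph"
  shows "has_weak_deriv v w"
  unfolding has_weak_deriv_def
proof safe
  fix \<eta> assume "test_fun \<eta>"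
  from H10_graph_by_parts[OF assms has_weak_deriv_test[OF this]]
  show "inner v (abs_L2 (deriv \<eta>)) = - inner w (abs_L2 \<eta>)"
    by (simp add: inner_commute)
qed

text \<open>On pairs (v, v') the norm of H1 is the product norm, so approximation by test functions
  in \<open>H1_norm\<close> amounts to membership in a closure in
  \<open>L2 \<times> L2\<close>.\<close>

lemma H10_iff: "v \<in> H10 \<longleftrightarrow> (v, weak_deriv v) \<in> H10_graph"
proof -
  have H1n: "H1_norm (v - abs_L2 \<eta>) = dist (abs_L2 \<eta>, abs_L2 (deriv \<eta>)) (v, weak_deriv v)"
    if "has_weak_deriv v (weak_deriv v)" "test_fun \<eta>" for \<eta>
  proof -
    have "weak_deriv (v - abs_L2 \<eta>) = weak_deriv v - abs_L2 (deriv \<eta>)"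
      by (intro weak_deriv_eq has_weak_deriv_diff has_weak_deriv_test that)
    then show ?thesis by (simp add: H1_norm_def dist_norm norm_Pair norm_minus_commute)
  qed
  show ?thesis
  proof
    assume v: "v \<in> H10"
    then have "has_weak_deriv v (weak_deriv v)" by (simp add: H10_def H1_iff)
    then show "(v, weak_deriv v) \<in> H10_graph"
      using v H1n unfolding H10_graph_def closure_approachable H10_def by fastforce
  next
    assume g: "(v, weak_deriv v) \<in> H10_graph"
    then have h: "has_weak_deriv v (weak_deriv v)" by (rule H10_graph_has_weak_deriv)
    show "v \<in> H10"
      unfolding H10_def H1_iff
    proof safe
      fix e :: real assume "e > 0"
      with g obtain \<eta> where "test_fun \<eta>" "dist (abs_L2 \<eta>, abs_L2 (deriv \<eta>)) (v, weak_deriv v) < e"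
        unfolding H10_graph_def closure_approachable by blast
      then show "\<exists>\<eta>. test_fun \<eta> \<and> H1_norm (v - abs_L2 \<eta>) < e" using H1n[OF h] by auto
    qed (rule h)
  qed
qed

text \<open>Cauchy-Schwarz for the pairing of \<open>deriv \<eta>\<close> with the indicator of
  [x, y]. With x = 0 it bounds the supremum, whence the Poincare constant 1; for general x and y it
  is the equicontinuity that Arzela-Ascoli asks for.\<close>

lemma test_fun_holder:
  assumes t: "test_fun \<eta>" and "0 \<le> x" "x \<le> y" "y \<le> 1"
  shows "\<bar>\<eta> y - \<eta> x\<bar> \<le> norm (abs_L2 (deriv \<eta>)) * sqrt (y - x)"
proof -
  have sq: "sq_integrable (indicator {x..y})" by (rule sq_integrable_indicator) simp
  have "\<eta> y - \<eta> x = (LINT s|unit_meas. deriv \<eta> s * indicator {x..y} s)"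
    by (rule LINT_indicator_derivative[symmetric]) (use assms test_fun_DERIV test_fun_continuous in auto)
  also have "\<dots> = inner (abs_L2 (deriv \<eta>)) (abs_L2 (indicator {x..y}))"
    by (simp add: inner_abs_L2 test_fun_sq_integrable t sq)
  finally have "\<bar>\<eta> y - \<eta> x\<bar> \<le> norm (abs_L2 (deriv \<eta>)) * norm (abs_L2 (indicator {x..y}))"
    using Cauchy_Schwarz_ineq2 by simp
  also have "norm (abs_L2 (indicator {x..y})) = sqrt (y - x)"
  proof -
    have "(LINT s|unit_meas. (indicat_real {x..y} s)\<^sup>2) = (LINT s|unit_meas. 1 * indicator {x..y} s)"
      by (intro Bochner_Integration.integral_cong) (auto split: split_indicator)
    also have "\<dots> = y - x"
      by (rule LINT_indicator_derivative[where F = "\<lambda>x. x"]) (use assms in auto)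
    finally show ?thesis by (simp add: norm_abs_L2 sq)
  qed
  finally show ?thesis .
qed

lemma test_fun_sup_bound:
  assumes t: "test_fun \<eta>" and "0 \<le> x" "x \<le> 1"
  shows "\<bar>\<eta> x\<bar> \<le> norm (abs_L2 (deriv \<eta>))"
proof -
  have "\<bar>\<eta> x\<bar> \<le> norm (abs_L2 (deriv \<eta>)) * sqrt x"
    using test_fun_holder[OF t, of 0 x] test_fun_boundary[OF t] assms by simp
  also have "\<dots> \<le> norm (abs_L2 (deriv \<eta>)) * 1"
    using assms by (intro mult_left_mono) auto
  finally show ?thesis by simp
qed

lemma norm_abs_L2_le_sup:
  assumes "sq_integrable f" "M \<ge> 0" "\<And>x. 0 < x \<Longrightarrow> x < 1 \<Longrightarrow> \<bar>f x\<bar> \<le> M"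
  shows "norm (abs_L2 f) \<le> M"
proof -
  have "(LINT x|unit_meas. (f x)\<^sup>2) \<le> (LINT x|unit_meas. M\<^sup>2)"
  proof (rule integral_mono)
    show "integrable unit_meas (\<lambda>x. (f x)\<^sup>2)" using assms(1) by auto
    show "integrable unit_meas (\<lambda>x. M\<^sup>2)"
      by (rule finite_measure.integrable_const[OF finite_measure_unit])
    show "(f x)\<^sup>2 \<le> M\<^sup>2" if "x \<in> space unit_meas" for x
      using that assms(2) assms(3)[of x] by (subst abs_le_square_iff[symmetric]) auto
  qed
  also have "\<dots> = M\<^sup>2" by (simp add: measure_restrict_space space_restrict_space)
  finally show ?thesis
    using assms(2) by (simp add: norm_abs_L2 assms(1) real_le_lsqrt)
qed

lemma poincare:
  assumes "(v, w) \<in> H10_graph"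
  shows "norm v \<le> norm w"
  using assms
proof (induction rule: H10_graph_induct)
  case closed
  show ?case
    unfolding case_prod_unfold by (intro closed_Collect_le continuous_intros)
next
  case (test \<eta>)
  show ?case
    by (rule norm_abs_L2_le_sup) (use test test_fun_sq_integrable test_fun_sup_bound in auto)
qed

lemma test_funs_compact:
  fixes s :: "nat \<Rightarrow> real \<Rightarrow> real"
  assumes t: "\<And>n. test_fun (s n)" and C: "\<And>n. norm (abs_L2 (deriv (s n))) \<le> C"
  obtains r l where "strict_mono (r :: nat \<Rightarrow> nat)" "(\<lambda>n. abs_L2 (s (r n))) \<longlonglongrightarrow> l"
proof -
  have C0: "C \<ge> 0" using C[of 0] norm_ge_zero order_trans by blast
  have hol: "\<bar>s n x - s n y\<bar> \<le> C * sqrt \<bar>x - y\<bar>" if "x \<in> {0..1}" "y \<in> {0..1}" for n x y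
  proof -
    have *: "\<bar>s n y - s n x\<bar> \<le> C * sqrt (y - x)" if "0 \<le> x" "x \<le> y" "y \<le> 1" for x y
      using order_trans[OF test_fun_holder[OF t[of n] that] mult_right_mono[OF C[of n]]] that by simp
    show ?thesis
      using *[of x y] *[of y x] that by (cases "x \<le> y") (auto simp: abs_minus_commute)
  qed
  obtain h r where hr: "continuous_on {0..1} h" "strict_mono (r :: nat \<Rightarrow> nat)"
    "\<And>e. 0 < e \<Longrightarrow> \<exists>N. \<forall>n x. n \<ge> N \<and> x \<in> {0..1} \<longrightarrow> norm (s (r n) x - h x) < e"
  proof (rule Arzela_Ascoli[of "{0..1::real}" s C])
    show "norm (s n x) \<le> C" if "x \<in> {0..1}" for n x
      using order_trans[OF test_fun_sup_bound[OF t[of n]] C[of n]] that by simp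
    fix x e :: real assume x: "x \<in> {0..1}" and e: "0 < e"
    \<comment> \<open>Chosen so that (C + 1) sqrt d = e; the added 1 avoids a division by zero when
      C = 0.\<close>
    define d where "d = (e / (C + 1))\<^sup>2"
    show "\<exists>d. 0 < d \<and> (\<forall>n y. y \<in> {0..1} \<and> norm (x - y) < d \<longrightarrow> norm (s n x - s n y) < e)"
    proof (intro exI[of _ d] conjI allI impI)
      show "d > 0" using e C0 by (simp add: d_def)
      fix n y assume y: "y \<in> {0..1} \<and> norm (x - y) < d"
      have "sqrt \<bar>x - y\<bar> < e / (C + 1)"
        using y e C0 by (intro real_less_lsqrt) (auto simp: d_def)
      then have "(C + 1) * sqrt \<bar>x - y\<bar> < e" using C0 by (simp add: field_simps)
      moreover have "C * sqrt \<bar>x - y\<bar> \<le> (C + 1) * sqrt \<bar>x - y\<bar>"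
        by (intro mult_right_mono) auto
      ultimately show "norm (s n x - s n y) < e"
        using hol[of x y n] x y by simp
    qed
  qed auto
  have "Cauchy (\<lambda>n. abs_L2 (s (r n)))"
  proof (rule CauchyI)
    fix e :: real assume e: "e > 0"
    then obtain N where N: "\<And>n x. n \<ge> N \<Longrightarrow> x \<in> {0..1} \<Longrightarrow> \<bar>s (r n) x - h x\<bar> < e / 3"
      using hr(3)[of "e / 3"] by auto
    have "norm (abs_L2 (s (r m)) - abs_L2 (s (r n))) < e" if mn: "m \<ge> N" "n \<ge> N" for m n
    proof -
      have "norm (abs_L2 (s (r m)) - abs_L2 (s (r n))) \<le> 2 * e / 3"
        unfolding minus_abs_L2[OF test_fun_sq_integrable(1)[OF t] test_fun_sq_integrable(1)[OF t]]
      proof (rule norm_abs_L2_le_sup)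
        show "sq_integrable (\<lambda>x. s (r m) x - s (r n) x)"
          by (intro sq_integrable_diff test_fun_sq_integrable t)
        show "\<bar>s (r m) x - s (r n) x\<bar> \<le> 2 * e / 3" if "0 < x" "x < 1" for x
        proof -
          have "\<bar>s (r m) x - h x\<bar> < e / 3" "\<bar>s (r n) x - h x\<bar> < e / 3"
            using N mn that by auto
          then show ?thesis by arith
        qed
      qed (use e in auto)
      then show ?thesis using e by simp
    qed
    then show "\<exists>M. \<forall>m\<ge>M. \<forall>n\<ge>M. norm (abs_L2 (s (r m)) - abs_L2 (s (r n))) < e" by blast
  qed
  then obtain l where "(\<lambda>n. abs_L2 (s (r n))) \<longlonglongrightarrow> l"
    unfolding Cauchy_convergent_iff convergent_def by blast
  then show ?thesis using that hr(2) by blast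
qed

text \<open>The compact embedding of H10 into L2. Test functions within 1/(n + 1) of the n-th pair
  in both components still have bounded derivatives, and in the first component the distance tends
  to 0, so a convergent subsequence of theirs is one for \<open>v\<close> as well.\<close>

lemma H10_graph_compact:
  fixes v w :: "nat \<Rightarrow> L2"
  assumes g: "\<And>n. (v n, w n) \<in> H10_graph" and C: "\<And>n. norm (w n) \<le> C"
  obtains r l where "strict_mono (r :: nat \<Rightarrow> nat)" "(\<lambda>n. v (r n)) \<longlonglongrightarrow> l"
proof -
  have "\<exists>\<eta>. test_fun \<eta> \<and> dist (abs_L2 \<eta>, abs_L2 (deriv \<eta>)) (v n, w n) < inverse (real (Suc n))" for n
  proof -
    have "0 < inverse (real (Suc n))" by simp
    then show ?thesis using g[of n] unfolding H10_graph_def closure_approachable by blast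
  qed
  then obtain s where s: "\<And>n. test_fun (s n)"
    "\<And>n. dist (abs_L2 (s n), abs_L2 (deriv (s n))) (v n, w n) < inverse (real (Suc n))"
    by metis
  have "norm (abs_L2 (deriv (s n))) \<le> C + 1" for n
  proof -
    have "dist (abs_L2 (deriv (s n))) (w n) \<le> inverse (real (Suc n))"
      using order_trans[OF dist_snd_le less_imp_le[OF s(2)[of n]]] by simp
    also have "\<dots> \<le> 1" by (simp add: field_simps)
    finally show ?thesis
      using C[of n] norm_triangle_sub[of "abs_L2 (deriv (s n))" "w n"] by (simp add: dist_norm)
  qed
  then obtain r l where r: "strict_mono (r :: nat \<Rightarrow> nat)" "(\<lambda>n. abs_L2 (s (r n))) \<longlonglongrightarrow> l"
    by (rule test_funs_compact[OF s(1)])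
  have "(\<lambda>n. v n - abs_L2 (s n)) \<longlonglongrightarrow> 0"
  proof (rule Lim_null_comparison[OF _ LIMSEQ_inverse_real_of_nat], rule always_eventually, rule allI)
    show "norm (v n - abs_L2 (s n)) \<le> inverse (real (Suc n))" for n
      using order_trans[OF dist_fst_le less_imp_le[OF s(2)[of n]]] by (simp add: dist_norm norm_minus_commute)
  qed
  from tendsto_add[OF LIMSEQ_subseq_LIMSEQ[OF this r(1)] r(2)]
  have "(\<lambda>n. v (r n)) \<longlonglongrightarrow> l" by (simp add: o_def)
  then show ?thesis using that r(1) by blast
qed

section \<open>Coercive forms and compact symmetric operators\<close>

text \<open>Existence by minimising the energy \<open>J\<close>, whose parallelogram identity makes
  minimising sequences Cauchy. \<open>X\<close> is merely a subspace, since it will consist of pairs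
  built from test functions; the minimiser therefore lies in the closure, while the equation is
  tested on \<open>X\<close> itself.\<close>

lemma coercive_variational:
  fixes X :: "'a :: {real_inner, complete_space} set"
  assumes X: "subspace X" and T: "bounded_linear T"
    and sym: "\<And>x y. inner (T x) y = inner x (T y)"
    and c: "c > 0" and coercive: "\<And>x. x \<in> X \<Longrightarrow> c * (norm x)\<^sup>2 \<le> inner (T x) x"
  obtains v where "v \<in> closure X" "\<And>x. x \<in> X \<Longrightarrow> inner (T v) x = inner k x"
proof -
  interpret T: bounded_linear T by (rule T)
  define J where "J x = inner (T x) x - 2 * inner k x" for x
  have J_add: "J (x + s *\<^sub>R y) = J x + 2 * s * (inner (T x) y - inner k y) + s\<^sup>2 * inner (T y) y" for x y s
    using sym[of y x] inner_commute[of y "T x"]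
    by (simp add: J_def T.add T.scaleR inner_add_left inner_add_right power2_eq_square algebra_simps)
  have par: "inner (T (x - y)) (x - y) = 2 * J x + 2 * J y - 4 * J ((1/2) *\<^sub>R (x + y))" for x y
    using sym[of y x] inner_commute[of y "T x"]
    by (simp add: J_def T.add T.diff T.scaleR inner_add_left inner_add_right inner_diff_left inner_diff_right algebra_simps)
  \<comment> \<open>Young's inequality, weighted by \<open>c\<close> so that coercivity absorbs the
    quadratic term.\<close>
  have lower: "- ((norm k)\<^sup>2 / c) \<le> J x" if "x \<in> X" for x
  proof -
    have "2 * inner k x \<le> 2 * (norm k * norm x)" using norm_cauchy_schwarz[of k x] by simp
    also have "\<dots> \<le> (norm k)\<^sup>2 / c + c * (norm x)\<^sup>2"
    proof -
      have "0 \<le> (norm k - c * norm x)\<^sup>2 / c" using c by simp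
      also have "\<dots> = (norm k)\<^sup>2 / c + c * (norm x)\<^sup>2 - 2 * (norm k * norm x)"
        using c by (simp add: power2_diff field_simps power2_eq_square)
      finally show ?thesis by simp
    qed
    finally show ?thesis using coercive[OF that] by (simp add: J_def)
  qed
  define m where "m = Inf (J ` X)"
  have ne: "X \<noteq> {}" using subspace_0[OF X] by auto
  have bdd: "bdd_below (J ` X)" using lower by (intro bdd_belowI2)
  have m_le: "m \<le> J x" if "x \<in> X" for x
    unfolding m_def using that bdd by (intro cInf_lower) auto
  have "\<exists>x\<in>X. J x < m + inverse (real (Suc n))" for n
  proof -
    have "Inf (J ` X) < m + inverse (real (Suc n))" unfolding m_def[symmetric] by simp
    then show ?thesis using ne bdd by (subst (asm) cInf_less_iff) auto
  qed
  then obtain x where x: "\<And>n. x n \<in> X" "\<And>n. J (x n) < m + inverse (real (Suc n))" by metis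
  have "Cauchy x"
  proof (rule CauchyI)
    fix e :: real assume e: "e > 0"
    have "\<forall>\<^sub>F n in sequentially. inverse (real (Suc n)) < c * e\<^sup>2 / 4"
      using order_tendstoD(2)[OF LIMSEQ_inverse_real_of_nat, of "c * e\<^sup>2 / 4"] c e by simp
    then obtain N where N: "\<And>n. n \<ge> N \<Longrightarrow> inverse (real (Suc n)) < c * e\<^sup>2 / 4"
      by (auto simp: eventually_sequentially)
    have "norm (x i - x j) < e" if "i \<ge> N" "j \<ge> N" for i j
    proof -
      \<comment> \<open>The midpoint lies in \<open>X\<close>, so its energy is at least
        \<open>m\<close>; the parallelogram identity then bounds the distance by the excess of the
        two energies over \<open>m\<close>.\<close>
      have "x i - x j \<in> X" "(1/2) *\<^sub>R (x i + x j) \<in> X"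
        using X x by (auto intro!: subspace_diff subspace_add subspace_scale)
      then have "c * (norm (x i - x j))\<^sup>2 \<le> 2 * J (x i) + 2 * J (x j) - 4 * m"
        using coercive par m_le by (smt (verit))
      also have "\<dots> < c * e\<^sup>2"
        using N[OF that(1)] N[OF that(2)] x(2)[of i] x(2)[of j] by linarith
      finally show ?thesis using c e by (simp add: power_less_imp_less_base)
    qed
    then show "\<exists>M. \<forall>m\<ge>M. \<forall>n\<ge>M. norm (x m - x n) < e" by blast
  qed
  then obtain v where v: "x \<longlonglongrightarrow> v"
    unfolding Cauchy_convergent_iff convergent_def by blast
  have J_lim: "(\<lambda>n. J (x n + y)) \<longlonglongrightarrow> J (v + y)" for y
    unfolding J_def by (intro tendsto_intros T.tendsto v)
  have Jm: "J v \<le> m"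
  proof (rule LIMSEQ_le)
    show "(\<lambda>n. J (x n)) \<longlonglongrightarrow> J v" using J_lim[of 0] by simp
    show "(\<lambda>n. m + inverse (real (Suc n))) \<longlonglongrightarrow> m"
      using tendsto_add[OF tendsto_const LIMSEQ_inverse_real_of_nat, of m] by simp
  qed (use x(2) less_imp_le in blast)
  have Jv: "m \<le> J (v + y)" if "y \<in> X" for y
    by (rule LIMSEQ_le_const[OF J_lim]) (use m_le x(1) that X in \<open>auto intro: subspace_add\<close>)
  have min: "0 \<le> s * (2 * (inner (T v) y - inner k y)) + s\<^sup>2 * inner (T y) y" if "y \<in> X" for y s
    using J_add[of v s y] Jm Jv[OF subspace_scale[OF X that, of s]] by (simp add: algebra_simps)
  have "inner (T v) y = inner k y" if y: "y \<in> X" for y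
  proof (rule ccontr)
    define a where "a = 2 * (inner (T v) y - inner k y)"
    define b where "b = inner (T y) y"
    assume "inner (T v) y \<noteq> inner k y"
    then have a: "a \<noteq> 0" by (simp add: a_def)
    have b: "b \<ge> 0" using coercive[OF y] c by (smt (verit) b_def mult_nonneg_nonneg zero_le_power2)
    \<comment> \<open>The quadratic s a + s^2 b would be smallest at -a / (2 b); with b + 1 in place
      of b the step is defined also for b = 0, and the value is still negative.\<close>
    define s where "s = - a / (2 * (b + 1))"
    have "2 * (b + 1) \<noteq> 0" using b by simp
    moreover have "d * (a / d) = a" if "d \<noteq> 0" for d using that by simp
    ultimately have "2 * (b + 1) * (a / (2 * (b + 1))) = a" by blast
    then have as: "a = - (2 * (b + 1)) * s" unfolding s_def by linarith
    have "s * a + s\<^sup>2 * b = s\<^sup>2 * (b - 2 * (b + 1))"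
      by (subst as) (simp add: power2_eq_square algebra_simps)
    also have "\<dots> < 0" using a b by (intro mult_pos_neg) (auto simp: s_def)
    finally show False using min[OF y, of s] by (simp add: a_def b_def)
  qed
  moreover have "v \<in> closure X" using x(1) v closure_sequential by blast
  ultimately show ?thesis using that by blast
qed

text \<open>With \<open>m\<close> the norm of \<open>K\<close> on \<open>V\<close>, symmetry gives
  |K K x - m^2 x|^2 \<le> m^2 (m^2 - |K x|^2) on the unit ball of \<open>V\<close>. A maximising
  sequence thus nearly solves K K x = m^2 x, and compactness yields an exact solution z. Factoring K
  K - m^2 as (K - m) (K + m) then gives an eigenvector for m or for -m.\<close>

lemma compact_symmetric_eigenvector:
  fixes K :: "'a :: real_inner \<Rightarrow> 'a"
  assumes V: "subspace V" "closed V" and KV: "\<And>x. x \<in> V \<Longrightarrow> K x \<in> V"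
    and K: "bounded_linear K" and sym: "\<And>x y. inner (K x) y = inner x (K y)"
    and cpt: "\<And>x :: nat \<Rightarrow> 'a. (\<And>n. norm (x n) \<le> 1) \<Longrightarrow> \<exists>r l. strict_mono (r :: nat \<Rightarrow> nat) \<and> (\<lambda>n. K (x (r n))) \<longlonglongrightarrow> l"
    and x0: "x0 \<in> V" "K x0 \<noteq> 0"
  obtains y m where "y \<in> V" "y \<noteq> 0" "m \<noteq> 0" "K y = m *\<^sub>R y"
proof -
  interpret K: bounded_linear K by (rule K)
  obtain C where C: "\<And>x. norm (K x) \<le> norm x * C" using K.bounded by blast
  define U where "U = {x \<in> V. norm x \<le> 1}"
  define m where "m = (SUP x\<in>U. norm (K x))"
  have ne: "U \<noteq> {}" using subspace_0[OF V(1)] by (auto simp: U_def)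
  have bdd: "bdd_above ((\<lambda>x. norm (K x)) ` U)"
  proof (rule bdd_aboveI2)
    fix x assume "x \<in> U"
    then have "norm x * \<bar>C\<bar> \<le> 1 * \<bar>C\<bar>" by (intro mult_right_mono) (auto simp: U_def)
    moreover have "norm x * C \<le> norm x * \<bar>C\<bar>" by (intro mult_left_mono) auto
    ultimately show "norm (K x) \<le> \<bar>C\<bar>" using C[of x] by simp
  qed
  have le_m: "norm (K x) \<le> m * norm x" if "x \<in> V" for x
  proof (cases "x = 0")
    case False
    then have "(1 / norm x) *\<^sub>R x \<in> U" using that V(1) by (auto simp: U_def intro: subspace_scale)
    then have "norm (K ((1 / norm x) *\<^sub>R x)) \<le> m" unfolding m_def using bdd by (intro cSUP_upper)
    then show ?thesis using False by (simp add: K.scaleR field_simps)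
  qed (simp add: K.zero)
  have m: "m > 0"
  proof -
    have "0 < norm (K x0)" using x0 by simp
    also have "\<dots> \<le> m * norm x0" by (rule le_m[OF x0(1)])
    finally show ?thesis by (simp add: zero_less_mult_iff)
  qed
  have "\<exists>x\<in>U. m - inverse (real (Suc n)) < norm (K x)" for n
  proof -
    have "m - inverse (real (Suc n)) < (SUP x\<in>U. norm (K x))" unfolding m_def[symmetric] by simp
    then show ?thesis using ne bdd by (subst (asm) less_cSUP_iff) auto
  qed
  then obtain x where xU: "\<And>n. x n \<in> U" and xm: "\<And>n. m - inverse (real (Suc n)) < norm (K (x n))" by metis
  have x: "x n \<in> V" "norm (x n) \<le> 1" for n using xU[of n] by (auto simp: U_def)
  obtain r w where r: "strict_mono (r :: nat \<Rightarrow> nat)" and w: "(\<lambda>n. K (x (r n))) \<longlonglongrightarrow> w"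
    using cpt x(2) by blast
  have norm_lim: "(\<lambda>n. norm (K (x n))) \<longlonglongrightarrow> m"
  proof (rule real_tendsto_sandwich)
    show "(\<lambda>n. m - inverse (real (Suc n))) \<longlonglongrightarrow> m"
      using tendsto_diff[OF tendsto_const LIMSEQ_inverse_real_of_nat, of m] by simp
    show "\<forall>\<^sub>F n in sequentially. norm (K (x n)) \<le> m"
      using order_trans[OF le_m[OF x(1)] mult_left_mono[OF x(2)]] m by (intro always_eventually) auto
  qed (use xm less_imp_le in \<open>auto intro!: always_eventually\<close>)
  have "(\<lambda>n. norm (K (K (x n)) - m\<^sup>2 *\<^sub>R x n)) \<longlonglongrightarrow> 0"
  proof (rule real_tendsto_sandwich[where f = "\<lambda>_. 0"])
    show "(\<lambda>n. sqrt (m\<^sup>2 * (m\<^sup>2 - (norm (K (x n)))\<^sup>2))) \<longlonglongrightarrow> 0"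
      using tendsto_real_sqrt[OF tendsto_mult[OF tendsto_const tendsto_diff[OF tendsto_const tendsto_power[OF norm_lim]]],
        of "m\<^sup>2" "m\<^sup>2" 2] by simp
    have "norm (K (K (x n)) - m\<^sup>2 *\<^sub>R x n) \<le> sqrt (m\<^sup>2 * (m\<^sup>2 - (norm (K (x n)))\<^sup>2))" for n
    proof (rule real_le_rsqrt)
      have "(norm (K (K (x n)) - m\<^sup>2 *\<^sub>R x n))\<^sup>2
          = (norm (K (K (x n))))\<^sup>2 - 2 * m\<^sup>2 * (norm (K (x n)))\<^sup>2 + m\<^sup>2 * m\<^sup>2 * (norm (x n))\<^sup>2"
        using sym[of "K (x n)" "x n"] inner_commute[of "x n" "K (K (x n))"]
        by (simp add: power2_norm_eq_inner inner_diff_left inner_diff_right algebra_simps)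
      also have "\<dots> \<le> m\<^sup>2 * (norm (K (x n)))\<^sup>2 - 2 * m\<^sup>2 * (norm (K (x n)))\<^sup>2 + m\<^sup>2 * m\<^sup>2 * 1"
      proof (intro add_mono diff_mono mult_left_mono order_refl)
        show "(norm (K (K (x n))))\<^sup>2 \<le> m\<^sup>2 * (norm (K (x n)))\<^sup>2"
          using power_mono[OF le_m[OF KV[OF x(1)]], of n 2] by (simp add: power_mult_distrib)
        show "(norm (x n))\<^sup>2 \<le> 1" using x(2)[of n] by (simp add: power_le_one)
      qed (auto intro!: mult_nonneg_nonneg)
      finally show "(norm (K (K (x n)) - m\<^sup>2 *\<^sub>R x n))\<^sup>2 \<le> m\<^sup>2 * (m\<^sup>2 - (norm (K (x n)))\<^sup>2)"
        by (simp add: algebra_simps)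
    qed
    then show "\<forall>\<^sub>F n in sequentially. norm (K (K (x n)) - m\<^sup>2 *\<^sub>R x n) \<le> sqrt (m\<^sup>2 * (m\<^sup>2 - (norm (K (x n)))\<^sup>2))"
      by simp
  qed auto
  then have "(\<lambda>n. K (K (x n)) - m\<^sup>2 *\<^sub>R x n) \<longlonglongrightarrow> 0" by (rule tendsto_norm_zero_cancel)
  from LIMSEQ_subseq_LIMSEQ[OF this r]
  have "(\<lambda>n. K (K (x (r n))) - m\<^sup>2 *\<^sub>R x (r n)) \<longlonglongrightarrow> 0" by (simp add: o_def)
  \<comment> \<open>Compactness makes only the images K x converge; the approximate equation K K x =
    m^2 x passes convergence on to the vectors x themselves.\<close>
  from tendsto_diff[OF K.tendsto[OF w] this]
  have "(\<lambda>n. m\<^sup>2 *\<^sub>R x (r n)) \<longlonglongrightarrow> K w" by simp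
  from tendsto_scaleR[OF tendsto_const this, of "1 / m\<^sup>2"]
  have z: "(\<lambda>n. x (r n)) \<longlonglongrightarrow> (1 / m\<^sup>2) *\<^sub>R K w" using m by simp
  define z where "z = (1 / m\<^sup>2) *\<^sub>R K w"
  have zV: "z \<in> V" using closed_sequentially[OF V(2) _ z] x(1) by (simp add: z_def)
  have Kz: "K z = w" using LIMSEQ_unique[OF K.tendsto[OF z] w] by (simp add: z_def)
  have "norm w = m"
    using LIMSEQ_unique[OF tendsto_norm[OF w]] LIMSEQ_subseq_LIMSEQ[OF norm_lim r] by (simp add: o_def)
  then have z0: "z \<noteq> 0" using Kz m by (auto simp: K.zero)
  have KKz: "K (K z) = m\<^sup>2 *\<^sub>R z" using m by (simp add: Kz, simp add: z_def)
  show ?thesis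
  proof (cases "K z + m *\<^sub>R z = 0")
    case True
    then have "K z = (- m) *\<^sub>R z" by (simp add: eq_neg_iff_add_eq_0)
    then show ?thesis using that[of z "- m"] zV z0 m by simp
  next
    case False
    have "K (K z + m *\<^sub>R z) = m *\<^sub>R (K z + m *\<^sub>R z)"
      by (simp add: K.add K.scaleR KKz scaleR_add_right power2_eq_square)
    moreover have "K z + m *\<^sub>R z \<in> V"
      using V(1) KV zV by (intro subspace_add subspace_scale) auto
    ultimately show ?thesis using that[of "K z + m *\<^sub>R z" m] False m by simp
  qed
qed

section \<open>The operator \<open>v'' - g v\<close>\<close>

lemma dom_L_iff: "v \<in> dom_L \<longleftrightarrow> (v, weak_deriv v) \<in> H10_graph \<and>
    has_weak_deriv (weak_deriv v) (weak_deriv (weak_deriv v))"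
  unfolding dom_L_def H2_def using H10_iff H1_iff H10_graph_has_weak_deriv by auto

locale nonneg_potential =
  fixes g :: "real \<Rightarrow> real"
  assumes g_Linfty: "g \<in> Linfty" and g_nonneg: "AE x in unit_meas. 0 \<le> g x"
begin

lemma g_measurable: "g \<in> borel_measurable unit_meas"
  using g_Linfty by (simp add: Linfty_def)

lemma g_bound: obtains C where "C \<ge> 0" "AE x in unit_meas. \<bar>g x\<bar> \<le> C"
proof -
  obtain C where C: "AE x in unit_meas. \<bar>g x\<bar> \<le> C" using g_Linfty by (auto simp: Linfty_def)
  show ?thesis
    by (rule that[of "\<bar>C\<bar>"]) (use C in \<open>auto elim: eventually_mono\<close>)
qed

lemma sq_integrable_g_mult: "sq_integrable (\<lambda>x. g x * rep_L2 v x)"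
proof -
  obtain C where C: "C \<ge> 0" "AE x in unit_meas. \<bar>g x\<bar> \<le> C" by (rule g_bound)
  show ?thesis
  proof (rule sq_integrable_AE_bound[OF sq_integrable_scale[OF sq_integrable_rep, of C v]])
    show "(\<lambda>x. g x * rep_L2 v x) \<in> borel_measurable unit_meas"
      using g_measurable sq_integrableD(1)[OF sq_integrable_rep] by (rule borel_measurable_times)
    show "AE x in unit_meas. \<bar>g x * rep_L2 v x\<bar> \<le> \<bar>C * rep_L2 v x\<bar>"
      using C(2) by eventually_elim (auto simp: abs_mult intro: mult_right_mono)
  qed
qed

lemma inner_mult_L2: "inner (mult_L2 g v) w = (LINT x|unit_meas. g x * rep_L2 v x * rep_L2 w x)"
  using inner_abs_L2[OF sq_integrable_g_mult sq_integrable_rep, of v w] by (simp add: mult_L2_def)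

lemma mult_L2_symmetric: "inner (mult_L2 g v) w = inner v (mult_L2 g w)"
  unfolding inner_commute[of v] inner_mult_L2 by (simp add: mult_ac)

lemma mult_L2_nonneg: "0 \<le> inner (mult_L2 g v) v"
  unfolding inner_mult_L2
proof (rule integral_nonneg_AE)
  show "AE x in unit_meas. 0 \<le> g x * rep_L2 v x * rep_L2 v x"
    using g_nonneg by eventually_elim (simp add: mult.assoc)
qed

lemma bounded_linear_mult_L2: "bounded_linear (mult_L2 g)"
proof -
  obtain C where C: "C \<ge> 0" "AE x in unit_meas. \<bar>g x\<bar> \<le> C" by (rule g_bound)
  have "norm (mult_L2 g v) \<le> norm v * C" for v
  proof -
    have "(norm (mult_L2 g v))\<^sup>2 = (LINT x|unit_meas. (g x * rep_L2 v x)\<^sup>2)"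
      unfolding mult_L2_def norm_abs_L2[OF sq_integrable_g_mult] by simp
    also have "\<dots> \<le> (LINT x|unit_meas. C\<^sup>2 * (rep_L2 v x)\<^sup>2)"
    proof (rule integral_mono_AE)
      show "integrable unit_meas (\<lambda>x. (g x * rep_L2 v x)\<^sup>2)" using sq_integrable_g_mult by auto
      show "integrable unit_meas (\<lambda>x. C\<^sup>2 * (rep_L2 v x)\<^sup>2)"
        using sq_integrableD(2)[OF sq_integrable_rep] by simp
      show "AE x in unit_meas. (g x * rep_L2 v x)\<^sup>2 \<le> C\<^sup>2 * (rep_L2 v x)\<^sup>2"
        using C(2)
      proof eventually_elim
        case (elim x)
        then have "\<bar>g x * rep_L2 v x\<bar> \<le> \<bar>C * rep_L2 v x\<bar>"
          by (auto simp: abs_mult intro: mult_right_mono)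
        then show ?case by (simp only: abs_le_square_iff power_mult_distrib)
      qed
    qed
    also have "\<dots> = (norm v * C)\<^sup>2"
      using norm_abs_L2[OF sq_integrable_rep, of v] by (simp add: power_mult_distrib)
    finally show ?thesis using C(1) by (intro power2_le_imp_le[of "norm (mult_L2 g v)" "norm v * C"]) auto
  qed
  then show ?thesis
  proof (rule bounded_linear_intro[rotated 2])
    \<comment> \<open>Symmetry moves the operator to an arbitrary test vector, where linearity is
      that of the inner product; representatives chosen by \<open>rep_L2\<close> add up only almost
      everywhere.\<close>
    show "mult_L2 g (v + w) = mult_L2 g v + mult_L2 g w" for v w
      by (subst vector_eq_rdot[symmetric])
        (simp add: inner_add_left mult_L2_symmetric)
    show "mult_L2 g (c *\<^sub>R v) = c *\<^sub>R mult_L2 g v" for c v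
      by (subst vector_eq_rdot[symmetric]) (simp add: mult_L2_symmetric)
  qed
qed

lemma dom_LI:
  assumes "(v, w) \<in> H10_graph" "has_weak_deriv w z"
  shows "v \<in> dom_L" "op_L g v = z - mult_L2 g v"
proof -
  have "weak_deriv v = w" "weak_deriv w = z"
    using assms by (auto intro: weak_deriv_eq H10_graph_has_weak_deriv)
  then show "v \<in> dom_L" "op_L g v = z - mult_L2 g v"
    using assms by (auto simp: dom_L_iff op_L_def)
qed

lemma op_L_form:
  assumes "v \<in> dom_L" "w \<in> dom_L"
  shows "inner (op_L g v) w = - inner (weak_deriv v) (weak_deriv w) - inner (mult_L2 g v) w"
  using H10_graph_by_parts[of w "weak_deriv w" "weak_deriv v" "weak_deriv (weak_deriv v)"] assms
  by (simp add: dom_L_iff op_L_def inner_diff_left)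

lemma op_L_symmetric: "v \<in> dom_L \<Longrightarrow> w \<in> dom_L \<Longrightarrow> inner (op_L g v) w = inner v (op_L g w)"
  using op_L_form[of v w] op_L_form[of w v] mult_L2_symmetric[of v w]
  by (simp add: inner_commute[of v] inner_commute[of "weak_deriv v"])

lemma op_L_coercive:
  assumes "v \<in> dom_L"
  shows "(norm (weak_deriv v))\<^sup>2 \<le> inner (- op_L g v) v"
  using op_L_form[OF assms assms] mult_L2_nonneg[of v] by (simp add: power2_norm_eq_inner)

text \<open>Coercivity combined with the Poincare constant 1. Positivity is what legitimises the
  divisions by \<mu> and sqrt \<mu> in the modes.\<close>

lemma eigenvalue_ge_1:
  assumes "\<omega> \<in> dom_L" "\<omega> \<noteq> 0" "- op_L g \<omega> = \<mu> *\<^sub>R \<omega>"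
  shows "1 \<le> \<mu>"
proof -
  have "(norm \<omega>)\<^sup>2 \<le> (norm (weak_deriv \<omega>))\<^sup>2"
    using poincare assms(1) by (intro power_mono) (auto simp: dom_L_iff)
  also have "\<dots> \<le> \<mu> * (norm \<omega>)\<^sup>2"
    using op_L_coercive[OF assms(1)] unfolding assms(3) by (simp add: power2_norm_eq_inner)
  finally show ?thesis using assms(2) by simp
qed

text \<open>The weak equation (v', \<eta>') + (g v, \<eta>) = (h, \<eta>) for all test functions
  says by definition that v' has the weak derivative g v - h, so the energy minimiser lies in H2 at
  once. Posing the problem on pairs (\<eta>, \<eta>') keeps \<open>T\<close> bounded although
  differentiation is not.\<close>

lemma op_L_surj: obtains v where "v \<in> dom_L" "- op_L g v = h"
proof -
  define X where "X = {(abs_L2 \<eta>, abs_L2 (deriv \<eta>)) | \<eta>. test_fun \<eta>}"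
  define T where "T x = (mult_L2 g (fst x), snd x)" for x :: "L2 \<times> L2"
  have comb: "x + c *\<^sub>R y \<in> X" if xy: "x \<in> X" "y \<in> X" for x y c
  proof -
    obtain \<eta> \<zeta> where t: "test_fun \<eta>" "x = (abs_L2 \<eta>, abs_L2 (deriv \<eta>))"
        "test_fun \<zeta>" "y = (abs_L2 \<zeta>, abs_L2 (deriv \<zeta>))"
      using xy unfolding X_def by blast
    then have "x + c *\<^sub>R y = (abs_L2 (\<lambda>x. \<eta> x + c * \<zeta> x), abs_L2 (deriv (\<lambda>x. \<eta> x + c * \<zeta> x)))"
      by (simp add: deriv_lincomb abs_L2_lincomb test_fun_sq_integrable)
    then show ?thesis unfolding X_def using test_fun_lincomb[OF t(1,3)] by blast
  qed
  have "subspace X"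
  proof -
    \<comment> \<open>Any test function serves here: subtracting its pair from itself puts 0 into
      \<open>X\<close>.\<close>
    have "test_fun (bump (1/3) (2/3) 0)" by (rule test_fun_bump) auto
    then obtain x where "x \<in> X" unfolding X_def by blast
    from comb[OF this this, of "-1"] have 0: "0 \<in> X" by simp
    show ?thesis
      by (rule subspaceI) (use 0 comb[of _ _ 1] comb[OF 0] in auto)
  qed
  moreover have "bounded_linear T"
    unfolding T_def
    by (intro bounded_linear_Pair bounded_linear_compose[OF bounded_linear_mult_L2] bounded_linear_fst bounded_linear_snd)
  moreover have "inner (T x) y = inner x (T y)" for x y
    by (simp add: T_def inner_prod_def mult_L2_symmetric)
  moreover have "(0::real) < 1/2" by simp
  \<comment> \<open>By Poincare |v|^2 + |v'|^2 \<le> 2 |v'|^2, and the potential only adds a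
    nonnegative term; hence the constant 1/2.\<close>
  moreover have "(1/2) * (norm x)\<^sup>2 \<le> inner (T x) x" if "x \<in> X" for x
  proof -
    have "x \<in> H10_graph" using that H10_graph_test by (auto simp: X_def)
    then have "norm (fst x) \<le> norm (snd x)" by (metis poincare prod.collapse)
    then have "(norm (fst x))\<^sup>2 \<le> (norm (snd x))\<^sup>2" by (intro power_mono) auto
    then show ?thesis using mult_L2_nonneg[of "fst x"]
      by (simp add: T_def inner_prod_def power2_norm_eq_inner)
  qed
  ultimately obtain x where x: "x \<in> closure X" "\<And>y. y \<in> X \<Longrightarrow> inner (T x) y = inner (h, 0) y"
    by (rule coercive_variational[where c = "1/2" and k = "(h, 0)"]) (assumption, rule that)
  obtain v w where vw: "x = (v, w)" by (cases x)
  have graph: "(v, w) \<in> H10_graph" using x(1) by (simp add: vw H10_graph_def X_def)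
  have weak: "has_weak_deriv w (mult_L2 g v - h)"
    unfolding has_weak_deriv_def
  proof safe
    fix \<eta> assume "test_fun \<eta>"
    then have "(abs_L2 \<eta>, abs_L2 (deriv \<eta>)) \<in> X" by (auto simp: X_def)
    from x(2)[OF this] show "inner w (abs_L2 (deriv \<eta>)) = - inner (mult_L2 g v - h) (abs_L2 \<eta>)"
      by (simp add: T_def vw inner_diff_left)
  qed
  show ?thesis
    by (rule that[OF dom_LI(1)[OF graph weak]]) (simp add: dom_LI(2)[OF graph weak])
qed

lemma eigenfunctions_complete:
  assumes orth: "\<And>\<omega> \<mu>. \<omega> \<in> dom_L \<Longrightarrow> \<omega> \<noteq> 0 \<Longrightarrow> - op_L g \<omega> = \<mu> *\<^sub>R \<omega> \<Longrightarrow> inner v \<omega> = 0"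
  shows "v = 0"
proof (rule ccontr)
  assume v0: "v \<noteq> 0"
  define E where "E = {\<omega> \<in> dom_L. \<omega> \<noteq> 0 \<and> (\<exists>\<mu>. - op_L g \<omega> = \<mu> *\<^sub>R \<omega>)}"
  define V where "V = {v. \<forall>\<omega>\<in>E. inner v \<omega> = 0}"
  \<comment> \<open>Any choice of preimages will do: symmetry of \<open>op_L\<close> makes
    \<open>K\<close> symmetric, and a symmetric map defined on the whole space is linear.\<close>
  define K where "K h = (SOME v. v \<in> dom_L \<and> - op_L g v = h)" for h
  have K: "K h \<in> dom_L" "- op_L g (K h) = h" for h
  proof -
    have "\<exists>v. v \<in> dom_L \<and> - op_L g v = h" using op_L_surj by metis
    then have "K h \<in> dom_L \<and> - op_L g (K h) = h" unfolding K_def by (rule someI_ex)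
    then show "K h \<in> dom_L" "- op_L g (K h) = h" by auto
  qed
  have sym: "inner (K h) k = inner h (K k)" for h k
    using op_L_symmetric[OF K(1)[of h] K(1)[of k]] K(2)[of h] K(2)[of k]
    by (metis inner_minus_left inner_minus_right)
  have K_graph: "(K h, weak_deriv (K h)) \<in> H10_graph" for h
    using K(1)[of h] by (simp add: dom_L_iff)
  \<comment> \<open>The derivative of \<open>K h\<close> is bounded, not only \<open>K h\<close>,
    because compactness is drawn from bounded derivatives.\<close>
  have K_deriv: "norm (weak_deriv (K h)) \<le> norm h" for h
  proof -
    have "(norm (weak_deriv (K h)))\<^sup>2 \<le> inner h (K h)" using op_L_coercive[OF K(1)[of h]] K(2)[of h] by simp
    also have "\<dots> \<le> norm h * norm (K h)" by (rule norm_cauchy_schwarz)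
    also have "\<dots> \<le> norm h * norm (weak_deriv (K h))"
      by (intro mult_left_mono poincare[OF K_graph]) simp
    finally show ?thesis
      by (cases "weak_deriv (K h) = 0") (auto simp: power2_eq_square)
  qed
  have "bounded_linear K"
  proof (rule bounded_linear_intro[where K = 1])
    show "K (x + y) = K x + K y" for x y
      by (subst vector_eq_rdot[symmetric]) (simp add: inner_add_left sym)
    show "K (c *\<^sub>R x) = c *\<^sub>R K x" for c x
      by (subst vector_eq_rdot[symmetric]) (simp add: sym)
    show "norm (K x) \<le> norm x * 1" for x
      using order_trans[OF poincare[OF K_graph] K_deriv] by simp
  qed
  moreover have "subspace V" by (auto simp: subspace_def V_def inner_add_left)
  moreover have "closed V"
  proof -
    have "V = (\<Inter>\<omega>\<in>E. {v. inner v \<omega> = 0})" by (auto simp: V_def)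
    then show ?thesis by (auto intro!: closed_INT closed_Collect_eq continuous_intros)
  qed
  moreover have "K x \<in> V" if x: "x \<in> V" for x
    unfolding V_def
  proof safe
    fix \<omega> assume \<omega>: "\<omega> \<in> E"
    then obtain \<mu> where \<mu>: "\<omega> \<in> dom_L" "\<omega> \<noteq> 0" "- op_L g \<omega> = \<mu> *\<^sub>R \<omega>" by (auto simp: E_def)
    have "\<mu> * inner (K x) \<omega> = inner (K x) (- op_L g \<omega>)" by (simp add: \<mu>(3))
    also have "\<dots> = inner (- op_L g (K x)) \<omega>" using op_L_symmetric[OF K(1) \<mu>(1)] by simp
    also have "\<dots> = 0" using x \<omega> by (simp add: K(2) V_def)
    finally show "inner (K x) \<omega> = 0" using eigenvalue_ge_1[OF \<mu>] by simp
  qed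
  moreover have "\<exists>r l. strict_mono (r :: nat \<Rightarrow> nat) \<and> (\<lambda>n. K (x (r n))) \<longlonglongrightarrow> l"
    if "\<And>n. norm (x n) \<le> 1" for x :: "nat \<Rightarrow> L2"
  proof -
    have "norm (weak_deriv (K (x n))) \<le> 1" for n using order_trans[OF K_deriv that] .
    with H10_graph_compact[OF K_graph] obtain r l
      where "strict_mono (r :: nat \<Rightarrow> nat)" "(\<lambda>n. K (x (r n))) \<longlonglongrightarrow> l" by metis
    then show ?thesis by blast
  qed
  moreover have "v \<in> V" using orth by (auto simp: V_def E_def)
  moreover have "K v \<noteq> 0"
  proof
    assume "K v = 0"
    moreover have "weak_deriv (0::L2) = 0" by (intro weak_deriv_eq) (simp add: has_weak_deriv_def)
    then have "op_L g (0::L2) = 0"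
      using linear_0[OF bounded_linear.linear, OF bounded_linear_mult_L2] by (simp add: op_L_def)
    ultimately show False using v0 K(2)[of v] by simp
  qed
  ultimately obtain y m where y: "y \<in> V" "y \<noteq> 0" "m \<noteq> 0" "K y = m *\<^sub>R y"
    using compact_symmetric_eigenvector[of V K v] sym by blast
  \<comment> \<open>\<open>K y\<close> is an eigenfunction of -L with eigenvalue 1/m and a nonzero
    multiple of y, yet y in \<open>V\<close> is orthogonal to it.\<close>
  have "- op_L g (K y) = (1 / m) *\<^sub>R K y" unfolding K(2) using y(3,4) by simp
  moreover have "K y \<noteq> 0" using y by simp
  ultimately have "K y \<in> E" unfolding E_def using K(1) by blast
  then have "inner y (K y) = 0" using y(1) by (simp add: V_def)
  then show False using y by simp
qed

end

section \<open>The scalar equations\<close>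

text \<open>An affine substitution in the Beta integral. It serves twice: with x = 0 for fractional
  integrals of powers, and with general endpoints for composing the two Abel kernels.\<close>

lemma has_bochner_integral_Beta_interval:
  fixes a b x y :: real
  assumes "a > 0" "b > 0" "x < y"
  shows "has_bochner_integral lborel (\<lambda>r. indicator {x<..<y} r *\<^sub>R ((r - x) powr (a - 1) * (y - r) powr (b - 1)))
    ((y - x) powr (a + b - 1) * Beta a b)"
proof -
  let ?f = "\<lambda>t::real. t powr (a - 1) * (1 - t) powr (b - 1)"
  have "set_lebesgue_integral lborel {0..1} ?f = Beta a b"
    using set_borel_integral_eq_integral(2)[OF integrable_Beta[OF assms(1,2)]]
      integral_unique[OF has_integral_Beta_real[OF assms(1,2)]] by simp
  then have base: "has_bochner_integral lborel (\<lambda>t. indicator {0..1} t *\<^sub>R ?f t) (Beta a b)"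
    using integrable_Beta[OF assms(1,2)]
    by (simp add: has_bochner_integral_iff set_integrable_def set_lebesgue_integral_def)
  have "1 / (y - x) \<noteq> 0" using assms(3) by simp
  from iffD1[OF lborel_has_bochner_integral_real_affine_iff[OF this, where t = "- x / (y - x)"] base]
  have "has_bochner_integral lborel
      (\<lambda>r. indicator {0..1} (- x / (y - x) + 1 / (y - x) * r) *\<^sub>R ?f (- x / (y - x) + 1 / (y - x) * r))
      (Beta a b /\<^sub>R \<bar>1 / (y - x)\<bar>)"
    by simp
  \<comment> \<open>The factor undoes the powers of y - x that the substitution leaves in the two
    bases; the Jacobian supplies the remaining power.\<close>
  then have "has_bochner_integral lborel
      (\<lambda>r. (y - x) powr (a + b - 2) * (indicator {0..1} (- x / (y - x) + 1 / (y - x) * r) *\<^sub>R ?f (- x / (y - x) + 1 / (y - x) * r)))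
      ((y - x) powr (a + b - 2) * (Beta a b /\<^sub>R \<bar>1 / (y - x)\<bar>))"
    by (rule has_bochner_integral_mult_right)
  also have "(y - x) powr (a + b - 2) * (Beta a b /\<^sub>R \<bar>1 / (y - x)\<bar>) = (y - x) powr (a + b - 1) * Beta a b"
  proof -
    have "(y - x) powr (a + b - 1) = (y - x) powr (a + b - 2) * (y - x)"
      using assms(3) powr_add[of "y - x" "a + b - 2" 1] by simp
    then show ?thesis using assms(3) by simp
  qed
  also have "(\<lambda>r. (y - x) powr (a + b - 2) * (indicator {0..1} (- x / (y - x) + 1 / (y - x) * r) *\<^sub>R ?f (- x / (y - x) + 1 / (y - x) * r)))
      = (\<lambda>r. indicator {x<..<y} r *\<^sub>R ((r - x) powr (a - 1) * (y - r) powr (b - 1)))"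
  proof
    fix r
    have 1: "- x / (y - x) + 1 / (y - x) * r = (r - x) / (y - x)"
      by (simp add: diff_divide_distrib)
    have 2: "1 - (r - x) / (y - x) = (y - r) / (y - x)"
      using assms(3) by (simp add: field_simps)
    \<comment> \<open>At r = x and r = y both sides are 0 because \<open>0 powr c = 0\<close>, so
      the closed and the open interval give the same function and not merely the same
      integral.\<close>
    consider "r < x" | "r = x" | "x < r" "r < y" | "r = y" | "r > y" by linarith
    then show "(y - x) powr (a + b - 2) * (indicator {0..1} (- x / (y - x) + 1 / (y - x) * r) *\<^sub>R ?f (- x / (y - x) + 1 / (y - x) * r))
      = indicator {x<..<y} r *\<^sub>R ((r - x) powr (a - 1) * (y - r) powr (b - 1))"
    proof cases
      case 3
      have "(y - x) powr (a + b - 2) = (y - x) powr (a - 1) * (y - x) powr (b - 1)"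
        by (simp add: powr_add[symmetric])
      then show ?thesis unfolding 1 2 using 3 by (simp add: powr_divide)
    qed (unfold 1 2, use assms(3) in \<open>auto simp: indicator_def field_simps\<close>)
  qed
  finally show ?thesis .
qed

section \<open>The Abel equation and the Mittag-Leffler series\<close>

lemma set_integral_sum_lessThan:
  fixes f :: "nat \<Rightarrow> real \<Rightarrow> real"
  assumes "\<And>j. set_integrable M A (f j)"
  shows "set_integrable M A (\<lambda>s. \<Sum>j<n. f j s)"
    and "(LINT s:A|M. (\<Sum>j<n. f j s)) = (\<Sum>j<n. LINT s:A|M. f j s)"
  unfolding set_integrable_def set_lebesgue_integral_def scaleR_sum_right
  by (intro Bochner_Integration.integrable_sum Bochner_Integration.integral_sum
      assms[unfolded set_integrable_def])+

text \<open>A fractional integral sends powers to powers; the Gamma quotients telescope when it is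
  iterated, which is how the Mittag-Leffler coefficients arise.\<close>

lemma abel_powr:
  fixes \<alpha> b t :: real
  assumes "\<alpha> > 0" "b \<ge> 0" "t > 0"
  shows "set_integrable lborel {0<..<t} (\<lambda>s. (t - s) powr (\<alpha> - 1) * s powr b)" (is ?A)
    and "(LBINT s:{0<..<t}. (t - s) powr (\<alpha> - 1) * s powr b) =
      t powr (\<alpha> + b) * (Gamma (b + 1) * Gamma \<alpha> / Gamma (\<alpha> + b + 1))" (is ?B)
proof -
  have "has_bochner_integral lborel (\<lambda>s. indicator {0<..<t} s *\<^sub>R ((t - s) powr (\<alpha> - 1) * s powr b))
      (t powr (\<alpha> + b) * (Gamma (b + 1) * Gamma \<alpha> / Gamma (\<alpha> + b + 1)))"
    using has_bochner_integral_Beta_interval[of "b + 1" \<alpha> 0 t] assms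
    by (simp add: Beta_def mult.commute add_ac)
  then show ?A ?B
    by (auto simp: has_bochner_integral_iff set_integrable_def set_lebesgue_integral_def)
qed

lemma abel_integrable:
  fixes f :: "real \<Rightarrow> real"
  assumes "\<alpha> > 0" "t > 0" and f: "continuous_on {0<..<t} f" and M: "\<And>s. s \<in> {0<..<t} \<Longrightarrow> \<bar>f s\<bar> \<le> M"
  shows "set_integrable lborel {0<..<t} (\<lambda>s. (t - s) powr (\<alpha> - 1) * f s)"
proof (rule set_integrable_bound)
  \<comment> \<open>\<open>s powr 0\<close> is 1 on the interval; writing it brings the dominating
    function into the form of \<open>abel_powr\<close> with b = 0.\<close>
  show "set_integrable lborel {0<..<t} (\<lambda>s. M * ((t - s) powr (\<alpha> - 1) * s powr 0))"
    using abel_powr(1)[of \<alpha> 0 t] assms(1,2) by simp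
  have "continuous_on {0<..<t} (\<lambda>s. (t - s) powr (\<alpha> - 1) * f s)"
    by (intro continuous_intros f) auto
  from borel_measurable_continuous_on_indicator[OF _ this]
  show "set_borel_measurable lborel {0<..<t} (\<lambda>s. (t - s) powr (\<alpha> - 1) * f s)"
    by (simp add: set_borel_measurable_def)
  show "AE s in lborel. s \<in> {0<..<t} \<longrightarrow> norm ((t - s) powr (\<alpha> - 1) * f s) \<le> norm (M * ((t - s) powr (\<alpha> - 1) * s powr 0))"
  proof (intro AE_I2 impI)
    fix s assume s: "s \<in> {0<..<t}"
    then have "\<bar>f s\<bar> \<le> \<bar>M\<bar>" using M by fastforce
    then show "norm ((t - s) powr (\<alpha> - 1) * f s) \<le> norm (M * ((t - s) powr (\<alpha> - 1) * s powr 0))"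
      using s mult_left_mono[of "\<bar>f s\<bar>" "\<bar>M\<bar>" "(t - s) powr (\<alpha> - 1)"] by (auto simp: abs_mult mult_ac)
  qed
qed

text \<open>Discard Euler's integral before T and use t^y \<ge> T^y after it. Since T is free, Gamma
  outgrows every geometric sequence, an elementary stand-in for Stirling's formula.\<close>

lemma Gamma_lower_bound:
  fixes y T :: real
  assumes "y \<ge> 0" "T > 0"
  shows "T powr y * exp (- T) \<le> Gamma (y + 1)"
proof (rule has_integral_le)
  show "((\<lambda>t. t powr y / exp t) has_integral Gamma (y + 1)) {0..}"
    using Gamma_integral_real[of "y + 1"] assms by simp
  have "((\<lambda>t. T powr y * exp (- 1 * t)) has_integral (T powr y * (exp (- 1 * T) / 1))) {T..}"
    by (intro has_integral_mult_right has_integral_exp_minus_to_infinity) simp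
  then have "((\<lambda>t. T powr y * exp (- t)) has_integral (T powr y * exp (- T))) {T..}" by simp
  then show "((\<lambda>t. if t \<in> {T..} then T powr y * exp (- t) else 0) has_integral (T powr y * exp (- T))) {0..}"
    using assms by (subst has_integral_restrict) auto
  show "(if t \<in> {T..} then T powr y * exp (- t) else 0) \<le> t powr y / exp t" if "t \<in> {0..}" for t
    using assms that powr_mono2[of y T t] by (auto simp: exp_minus field_simps)
qed

lemma power_over_Gamma_tendsto_0:
  fixes \<alpha> x :: real
  assumes "\<alpha> > 0" "x \<ge> 0"
  shows "(\<lambda>n. x ^ n / Gamma (\<alpha> * real n + 1)) \<longlonglongrightarrow> 0"
proof -
  \<comment> \<open>Chosen so that T^\<alpha> = 2 x + 1; the resulting ratio x / (2 x + 1) is below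
    1 for every x \<ge> 0.\<close>
  define T where "T = (2 * x + 1) powr (1 / \<alpha>)"
  have T: "T > 0" using assms by (simp add: T_def)
  have Tn: "T powr (\<alpha> * real n) = (2 * x + 1) ^ n" for n
    using assms by (simp add: T_def powr_powr powr_realpow)
  have G: "Gamma (\<alpha> * real n + 1) > 0" for n
    using assms by (intro Gamma_real_pos) (simp add: add_nonneg_pos)
  show ?thesis
  proof (rule real_tendsto_sandwich[where f = "\<lambda>_. 0"])
    show "\<forall>\<^sub>F n in sequentially. 0 \<le> x ^ n / Gamma (\<alpha> * real n + 1)"
      using G assms by (auto intro!: always_eventually divide_nonneg_pos)
    have "x ^ n / Gamma (\<alpha> * real n + 1) \<le> exp T * (x / (2 * x + 1)) ^ n" for n
    proof -
      have "(2 * x + 1) ^ n * exp (- T) \<le> Gamma (\<alpha> * real n + 1)"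
        using Gamma_lower_bound[of "\<alpha> * real n" T] T Tn assms by simp
      then have "x ^ n / Gamma (\<alpha> * real n + 1) \<le> x ^ n / ((2 * x + 1) ^ n * exp (- T))"
        using assms G by (intro divide_left_mono) (auto intro!: mult_pos_pos)
      then show ?thesis by (simp add: power_divide exp_minus field_simps)
    qed
    then show "\<forall>\<^sub>F n in sequentially. x ^ n / Gamma (\<alpha> * real n + 1) \<le> exp T * (x / (2 * x + 1)) ^ n" by simp
    have "(\<lambda>n. (x / (2 * x + 1)) ^ n) \<longlonglongrightarrow> 0"
      using assms by (intro LIMSEQ_realpow_zero) auto
    from tendsto_mult[OF tendsto_const this, of "exp T"]
    show "(\<lambda>n. exp T * (x / (2 * x + 1)) ^ n) \<longlonglongrightarrow> 0" by simp
  qed auto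
qed

text \<open>Picard iteration: the right-hand side of the equation sends the partial sum
  \<open>P n\<close> to \<open>P (Suc n)\<close>. The error obeys the same recursion up to sign, so
  by induction it is at most M times the n-th term of a series of the same kind, which tends to
  0.\<close>

lemma abel_equation_solution:
  fixes S :: "real \<Rightarrow> real"
  assumes \<alpha>: "\<alpha> > 0" and lam: "\<mu> \<ge> 0" and S: "continuous_on {0..q} S"
    and eq: "\<And>t. t \<in> {0<..q} \<Longrightarrow> S t = S 0 - \<mu> / Gamma \<alpha> * (LBINT s:{0<..<t}. (t - s) powr (\<alpha> - 1) * S s)"
    and t: "t \<in> {0<..q}"
  shows "S t = S 0 * mittag_leffler \<alpha> 1 (- \<mu> * t powr \<alpha>)"
proof -
  define c where "c j = S 0 * (- \<mu>) ^ j / Gamma (\<alpha> * real j + 1)" for j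
  define P where "P n t = (\<Sum>j<n. c j * t powr (\<alpha> * real j))" for n t
  have G: "Gamma (\<alpha> * real n + 1) > 0" for n
    using \<alpha> by (intro Gamma_real_pos) (simp add: add_nonneg_pos)
  have G\<alpha>: "Gamma \<alpha> > 0" using \<alpha> by (rule Gamma_real_pos)
  obtain M where M: "\<And>s. s \<in> {0..q} \<Longrightarrow> \<bar>S s\<bar> \<le> M"
    using compact_imp_bounded[OF compact_continuous_image[OF S]] unfolding bounded_iff by fastforce
  have bound: "\<bar>S t - P n t\<bar> \<le> M * \<mu> ^ n * t powr (\<alpha> * real n) / Gamma (\<alpha> * real n + 1)"
    if "t \<in> {0<..q}" for t n
    using that
  proof (induction n arbitrary: t)
    case 0
    then show ?case using M[of t] by (simp add: P_def)
  next
    case (Suc n)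
    note t = \<open>t \<in> {0<..q}\<close>
    let ?k = "\<lambda>s. (t - s) powr (\<alpha> - 1)"
    have kS: "set_integrable lborel {0<..<t} (\<lambda>s. ?k s * S s)"
      using t by (intro abel_integrable[where M = M] continuous_on_subset[OF S] \<alpha> M) auto
    have kj: "set_integrable lborel {0<..<t} (\<lambda>s. ?k s * s powr (\<alpha> * real j))" for j
      using t \<alpha> by (intro abel_powr(1)) auto
    have kPj: "set_integrable lborel {0<..<t} (\<lambda>s. c j * (?k s * s powr (\<alpha> * real j)))" for j
      using kj by simp
    have P_eq: "?k s * P n s = (\<Sum>j<n. c j * (?k s * s powr (\<alpha> * real j)))" for s
      by (simp add: P_def sum_distrib_left mult_ac)
    have kP: "set_integrable lborel {0<..<t} (\<lambda>s. ?k s * P n s)"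
      unfolding P_eq using set_integral_sum_lessThan(1)[OF kPj] .
    have Ij: "(LBINT s:{0<..<t}. ?k s * s powr (\<alpha> * real j)) =
        t powr (\<alpha> * real (Suc j)) * (Gamma (\<alpha> * real j + 1) * Gamma \<alpha> / Gamma (\<alpha> * real (Suc j) + 1))" for j
      using abel_powr(2)[of \<alpha> "\<alpha> * real j" t] t \<alpha> by (simp add: algebra_simps)
    have "(LBINT s:{0<..<t}. ?k s * P n s) = (\<Sum>j<n. c j * (LBINT s:{0<..<t}. ?k s * s powr (\<alpha> * real j)))"
      unfolding P_eq set_integral_sum_lessThan(2)[OF kPj] by simp
    also have "\<mu> / Gamma \<alpha> * \<dots> = - (\<Sum>j<n. c (Suc j) * t powr (\<alpha> * real (Suc j)))"
      unfolding Ij sum_distrib_left sum_negf[symmetric]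
    proof (rule sum.cong[OF refl])
      fix j
      show "\<mu> / Gamma \<alpha> * (c j * (t powr (\<alpha> * real (Suc j)) * (Gamma (\<alpha> * real j + 1) * Gamma \<alpha> / Gamma (\<alpha> * real (Suc j) + 1))))
          = - (c (Suc j) * t powr (\<alpha> * real (Suc j)))"
        using G[of j] G[of "Suc j"] G\<alpha> by (simp add: c_def field_simps)
    qed
    also have "(\<Sum>j<n. c (Suc j) * t powr (\<alpha> * real (Suc j))) = P (Suc n) t - S 0"
      unfolding P_def by (subst sum.lessThan_Suc_shift) (use t in \<open>simp add: c_def\<close>)
    finally have "P (Suc n) t = S 0 - \<mu> / Gamma \<alpha> * (LBINT s:{0<..<t}. ?k s * P n s)" by simp
    then have "S t - P (Suc n) t = - (\<mu> / Gamma \<alpha>) * ((LBINT s:{0<..<t}. ?k s * S s) - (LBINT s:{0<..<t}. ?k s * P n s))"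
      using eq[OF t] by (simp add: algebra_simps)
    also have "(LBINT s:{0<..<t}. ?k s * S s) - (LBINT s:{0<..<t}. ?k s * P n s) = (LBINT s:{0<..<t}. ?k s * (S s - P n s))"
      using set_integral_diff(2)[OF kS kP] by (simp add: right_diff_distrib)
    finally have eq1: "\<bar>S t - P (Suc n) t\<bar> = \<mu> / Gamma \<alpha> * \<bar>LBINT s:{0<..<t}. ?k s * (S s - P n s)\<bar>"
      using lam G\<alpha> by (simp add: abs_mult)
    have le1: "\<bar>LBINT s:{0<..<t}. ?k s * (S s - P n s)\<bar> \<le>
        (LBINT s:{0<..<t}. (M * \<mu> ^ n / Gamma (\<alpha> * real n + 1)) * (?k s * s powr (\<alpha> * real n)))"
    proof -
      have int: "set_integrable lborel {0<..<t} (\<lambda>s. ?k s * (S s - P n s))"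
        using set_integral_diff(1)[OF kS kP] by (simp add: right_diff_distrib)
      have "\<bar>LBINT s:{0<..<t}. ?k s * (S s - P n s)\<bar> \<le> (LBINT s:{0<..<t}. \<bar>?k s * (S s - P n s)\<bar>)"
        using set_integral_norm_bound[OF int] by simp
      also have "\<dots> \<le> (LBINT s:{0<..<t}. (M * \<mu> ^ n / Gamma (\<alpha> * real n + 1)) * (?k s * s powr (\<alpha> * real n)))"
      proof (rule set_integral_mono)
        show "set_integrable lborel {0<..<t} (\<lambda>s. \<bar>?k s * (S s - P n s)\<bar>)"
          using set_integrable_abs[OF int] .
        show "set_integrable lborel {0<..<t} (\<lambda>s. (M * \<mu> ^ n / Gamma (\<alpha> * real n + 1)) * (?k s * s powr (\<alpha> * real n)))"
          using kj by simp
        show "\<bar>?k s * (S s - P n s)\<bar> \<le> (M * \<mu> ^ n / Gamma (\<alpha> * real n + 1)) * (?k s * s powr (\<alpha> * real n))"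
          if "s \<in> {0<..<t}" for s
          using mult_left_mono[OF Suc.IH[of s], of "?k s"] that t by (simp add: abs_mult mult_ac)
      qed
      finally show ?thesis .
    qed
    have eq2: "\<mu> / Gamma \<alpha> * (LBINT s:{0<..<t}. (M * \<mu> ^ n / Gamma (\<alpha> * real n + 1)) * (?k s * s powr (\<alpha> * real n)))
        = M * \<mu> ^ Suc n * t powr (\<alpha> * real (Suc n)) / Gamma (\<alpha> * real (Suc n) + 1)"
      unfolding set_integral_mult_right Ij using G[of n] G[of "Suc n"] G\<alpha> by (simp add: field_simps)
    show ?case
      unfolding eq1 eq2[symmetric] using le1 lam G\<alpha> by (intro mult_left_mono) auto
  qed
  define z where "z = - \<mu> * t powr \<alpha>"
  have tn: "t powr (\<alpha> * real n) = (t powr \<alpha>) ^ n" for n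
    using t by (simp add: powr_powr[symmetric] powr_realpow)
  have "(\<lambda>n. S t - P n t) \<longlonglongrightarrow> 0"
  proof (rule Lim_null_comparison)
    show "\<forall>\<^sub>F n in sequentially. norm (S t - P n t) \<le> M * ((\<mu> * t powr \<alpha>) ^ n / Gamma (\<alpha> * real n + 1))"
      using bound[OF t] by (intro always_eventually allI) (simp add: tn power_mult_distrib mult_ac)
    show "(\<lambda>n. M * ((\<mu> * t powr \<alpha>) ^ n / Gamma (\<alpha> * real n + 1))) \<longlonglongrightarrow> 0"
      using tendsto_mult[OF tendsto_const power_over_Gamma_tendsto_0[OF \<alpha>, of "\<mu> * t powr \<alpha>"], of M] lam by simp
  qed
  from tendsto_diff[OF tendsto_const this, of "S t"] have lim: "(\<lambda>n. P n t) \<longlonglongrightarrow> S t" by simp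
  have P_z: "P n t = S 0 * (\<Sum>j<n. z ^ j / Gamma (\<alpha> * real j + 1))" for n
    unfolding P_def c_def z_def tn sum_distrib_left
    by (intro sum.cong) (auto simp: power_mult_distrib power_minus[of "\<mu> * _"] power_minus[of \<mu>])
  \<comment> \<open>The limit of \<open>P n t\<close> determines the infinite sum only after
    division by S 0; if S 0 = 0, all partial sums vanish and so does S t.\<close>
  show ?thesis
  proof (cases "S 0 = 0")
    case True
    then show ?thesis using lim LIMSEQ_const_iff[of 0 "S t"] by (simp add: P_z)
  next
    case False
    from tendsto_divide[OF lim tendsto_const False]
    have "(\<lambda>j. z ^ j / Gamma (\<alpha> * real j + 1)) sums (S t / S 0)"
      unfolding P_z sums_def using False by simp
    then have "mittag_leffler \<alpha> 1 z = S t / S 0"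
      unfolding mittag_leffler_def by (rule sums_unique[symmetric])
    then show ?thesis using False by (simp add: z_def)
  qed
qed

text \<open>\<open>A\<close> and \<open>B / w\<close> are the phase-space point (S, D / w) turned
  back by the angle w t. Their derivatives vanish in the interior, and continuity extends constancy
  to the endpoints, where no derivative of D is given.\<close>

lemma oscillator_solution:
  fixes S D :: "real \<Rightarrow> real"
  assumes p: "p > 0" and w: "w > 0"
    and S: "\<And>t. t \<in> {-p..0} \<Longrightarrow> (S has_real_derivative D t) (at t within {-p..0})"
    and D: "continuous_on {-p..0} D"
    and D': "\<And>t. t \<in> {-p<..<0} \<Longrightarrow> (D has_real_derivative - w\<^sup>2 * S t) (at t)"
    and t: "t \<in> {-p..0}"
  shows "S t = S 0 * cos (w * t) + D 0 / w * sin (w * t)"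
proof -
  have Sc: "continuous_on {-p..0} S" using S by (rule DERIV_continuous_on)
  have S': "(S has_real_derivative D t) (at t)" if "t \<in> {-p<..<0}" for t
    using S[of t] that by (simp add: at_within_Icc_at)
  define A where "A t = S t * cos (w * t) - D t / w * sin (w * t)" for t
  define B where "B t = S t * (w * sin (w * t)) + D t * cos (w * t)" for t
  have const: "f t = f 0" if f: "continuous_on {-p..0} f" "\<And>t. t \<in> {-p<..<0} \<Longrightarrow> DERIV f t :> 0" "t \<in> {-p..0}"
    for f :: "real \<Rightarrow> real" and t
    using DERIV_isconst2[of "-p" 0 f t] DERIV_isconst2[of "-p" 0 f 0] p f by auto
  have At: "A t = A 0"
  proof (rule const[OF _ _ t])
    show "continuous_on {-p..0} A" unfolding A_def using w by (intro continuous_intros Sc D) auto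
    show "DERIV A t :> 0" if "t \<in> {-p<..<0}" for t
      unfolding A_def using w
      by (auto intro!: derivative_eq_intros S'[OF that] D'[OF that] simp: field_simps power2_eq_square)
  qed
  have Bt: "B t = B 0"
  proof (rule const[OF _ _ t])
    show "continuous_on {-p..0} B" unfolding B_def by (intro continuous_intros Sc D)
    show "DERIV B t :> 0" if "t \<in> {-p<..<0}" for t
      unfolding B_def
      by (auto intro!: derivative_eq_intros S'[OF that] D'[OF that] simp: algebra_simps power2_eq_square)
  qed
  have SAB: "S t = A t * cos (w * t) + B t / w * sin (w * t)"
  proof -
    have "(S t * c - D t / w * s) * c + (S t * (w * s) + D t * c) / w * s = S t * (c\<^sup>2 + s\<^sup>2)" for c s
    proof -
      have "(S t * (w * s) + D t * c) / w = S t * s + D t / w * c"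
        using w by (simp add: add_divide_distrib)
      then show ?thesis by (simp add: algebra_simps power2_eq_square)
    qed
    from this[of "cos (w * t)" "sin (w * t)"] show ?thesis unfolding A_def B_def by simp
  qed
  have "A 0 = S 0" "B 0 = D 0" by (auto simp: A_def B_def)
  then show ?thesis using SAB unfolding At Bt by simp
qed

text \<open>The integrated equation, with the exponent \<open>1 - 1\<close> left as it stands so
  that it matches the premise of \<open>abel_equation_solution\<close> at \<alpha> = 1; on (0, t)
  this kernel equals 1.\<close>

lemma ode_imp_abel_equation:
  fixes S :: "real \<Rightarrow> real"
  assumes S: "continuous_on {0..q} S" and d: "\<And>s. s \<in> {0<..<q} \<Longrightarrow> DERIV S s :> - \<mu> * S s"
    and t: "t \<in> {0<..q}"
  shows "S t = S 0 - \<mu> / Gamma 1 * (LBINT s:{0<..<t}. (t - s) powr (1 - 1) * S s)"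
proof -
  have St: "continuous_on {0..t} S" using t by (intro continuous_on_subset[OF S]) auto
  obtain M where M: "\<And>s. s \<in> {0..t} \<Longrightarrow> \<bar>S s\<bar> \<le> M"
    using compact_imp_bounded[OF compact_continuous_image[OF St]] unfolding bounded_iff by fastforce
  have int: "set_integrable lborel {0<..<t} (\<lambda>s. (t - s) powr (1 - 1) * S s)"
    using t by (intro abel_integrable[where M = M] continuous_on_subset[OF St] M) auto
  have "((\<lambda>s. - \<mu> * S s) has_integral (S t - S 0)) {0..t}"
    using t d by (intro fundamental_theorem_of_calculus_interior St)
      (auto simp: has_real_derivative_iff_has_vector_derivative[symmetric])
  then have "((\<lambda>s. - \<mu> * S s) has_integral (S t - S 0)) {0<..<t}"
    by (simp only: has_integral_Icc_iff_Ioo)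
  moreover have "((\<lambda>s. (t - s) powr (1 - 1) * S s) has_integral (LBINT s:{0<..<t}. (t - s) powr (1 - 1) * S s)) {0<..<t}"
    using set_borel_integral_eq_integral[OF int] by (simp add: has_integral_integral)
  then have "(S has_integral (LBINT s:{0<..<t}. (t - s) powr (1 - 1) * S s)) {0<..<t}"
    by (rule has_integral_eq[rotated]) simp
  then have "((\<lambda>s. - \<mu> * S s) has_integral (- \<mu> * (LBINT s:{0<..<t}. (t - s) powr (1 - 1) * S s))) {0<..<t}"
    by (rule has_integral_mult_right)
  ultimately have "S t - S 0 = - \<mu> * (LBINT s:{0<..<t}. (t - s) powr (1 - 1) * S s)"
    by (rule has_integral_unique)
  then show ?thesis by simp
qed

text \<open>Apply the fractional integral of order \<open>\<alpha>\<close> to the equation: by Fubini's theorem the two kernels compose to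
  the constant \<open>B(1 - \<alpha>, \<alpha>) = \<Gamma>(1 - \<alpha>) \<Gamma>(\<alpha>)\<close>, which leaves \<open>S t - S 0\<close>.\<close>

lemma caputo_imp_abel_equation:
  fixes S d :: "real \<Rightarrow> real"
  assumes \<alpha>: "0 < \<alpha>" "\<alpha> < 1" and S: "continuous_on {0..q} S"
    and d: "\<And>s. s \<in> {0<..<q} \<Longrightarrow> DERIV S s :> d s" and dc: "continuous_on {0<..q} d"
    and int: "\<And>t. t \<in> {0<..q} \<Longrightarrow> set_integrable lborel {0<..<t} (\<lambda>s. (t - s) powr (- \<alpha>) * d s)"
    and eq: "\<And>t. t \<in> {0<..q} \<Longrightarrow>
      1 / Gamma (1 - \<alpha>) * (LBINT s:{0<..<t}. (t - s) powr (- \<alpha>) * d s) = - \<mu> * S t"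
    and t: "t \<in> {0<..q}"
  shows "S t = S 0 - \<mu> / Gamma \<alpha> * (LBINT s:{0<..<t}. (t - s) powr (\<alpha> - 1) * S s)"
proof -
  define e where "e s = indicator {0<..<t} s *\<^sub>R d s" for s
  \<comment> \<open>\<open>F\<close> lives on the triangle 0 < s < r < t. Integrating over r first
    leaves \<open>e s\<close> times the constant \<open>B\<close>; integrating over s first leaves
    the Caputo integral at time r.\<close>
  define F where "F s r = (if s < r \<and> r < t then (r - s) powr (- \<alpha>) * (t - r) powr (\<alpha> - 1) * e s else 0)" for s r
  define B where "B = Beta (1 - \<alpha>) \<alpha>"
  have G: "Gamma (1 - \<alpha>) > 0" "Gamma \<alpha> > 0" using \<alpha> by (auto intro!: Gamma_real_pos)
  have B: "B = Gamma (1 - \<alpha>) * Gamma \<alpha>" by (simp add: B_def Beta_def)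
  have em [measurable]: "e \<in> borel_measurable borel"
    unfolding e_def
    by (rule borel_measurable_continuous_on_indicator) (use t in \<open>auto intro: continuous_on_subset[OF dc]\<close>)
  \<comment> \<open>\<open>d\<close> may be unbounded near 0. Its integrability is extracted from
    that of the Caputo integrand at time t, whose kernel is at least t^(-\<alpha>); both Fubini and
    the identification of the integral of \<open>d\<close> with S t - S 0 rest on it.\<close>
  have "set_integrable lborel {0<..<t} d"
  proof (rule set_integrable_bound)
    show "set_integrable lborel {0<..<t} (\<lambda>s. t powr \<alpha> * ((t - s) powr (- \<alpha>) * d s))"
      using int[OF t] by simp
    show "set_borel_measurable lborel {0<..<t} d"
      using em unfolding set_borel_measurable_def e_def by simp
    show "AE s in lborel. s \<in> {0<..<t} \<longrightarrow> norm (d s) \<le> norm (t powr \<alpha> * ((t - s) powr (- \<alpha>) * d s))"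
    proof (intro AE_I2 impI)
      fix s assume s: "s \<in> {0<..<t}"
      then have "t powr (- \<alpha>) \<le> (t - s) powr (- \<alpha>)" using \<alpha> by (intro powr_mono2') auto
      then have "t powr \<alpha> * t powr (- \<alpha>) \<le> t powr \<alpha> * (t - s) powr (- \<alpha>)" by (intro mult_left_mono) auto
      then have "1 \<le> t powr \<alpha> * (t - s) powr (- \<alpha>)" using t by (simp add: powr_minus)
      then have "1 * \<bar>d s\<bar> \<le> (t powr \<alpha> * (t - s) powr (- \<alpha>)) * \<bar>d s\<bar>" by (intro mult_right_mono) auto
      then show "norm (d s) \<le> norm (t powr \<alpha> * ((t - s) powr (- \<alpha>) * d s))" by (simp add: abs_mult mult.assoc)
    qed
  qed
  note d_int = this
  have e: "integrable lborel e"
    using d_int unfolding set_integrable_def e_def .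
  have e': "integral\<^sup>L lborel e = integral {0<..<t} d"
    using set_borel_integral_eq_integral(2)[OF d_int] unfolding set_lebesgue_integral_def e_def .
  have "(d has_integral (S t - S 0)) {0..t}"
    using t d by (intro fundamental_theorem_of_calculus_interior continuous_on_subset[OF S])
      (auto simp: has_real_derivative_iff_has_vector_derivative[symmetric])
  then have "integral {0<..<t} d = S t - S 0"
    unfolding has_integral_Icc_iff_Ioo by (rule integral_unique)
  then have e_int: "integral\<^sup>L lborel e = S t - S 0" using e' by simp
  have kernel: "has_bochner_integral lborel (\<lambda>r. c * (indicator {s<..<t} r *\<^sub>R ((r - s) powr (- \<alpha>) * (t - r) powr (\<alpha> - 1)))) (c * B)"
    if "s < t" for s c
    using has_bochner_integral_mult_right[OF has_bochner_integral_Beta_interval[of "1 - \<alpha>" \<alpha> s t], of c] \<alpha> that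
    by (simp add: B_def)
  have F1: "has_bochner_integral lborel (F s) (e s * B) \<and> has_bochner_integral lborel (\<lambda>r. norm (F s r)) (\<bar>e s\<bar> * B)" for s
  proof (cases "s \<in> {0<..<t}")
    case True
    have "F s = (\<lambda>r. e s * (indicator {s<..<t} r *\<^sub>R ((r - s) powr (- \<alpha>) * (t - r) powr (\<alpha> - 1))))"
      "(\<lambda>r. norm (F s r)) = (\<lambda>r. \<bar>e s\<bar> * (indicator {s<..<t} r *\<^sub>R ((r - s) powr (- \<alpha>) * (t - r) powr (\<alpha> - 1))))"
      by (auto simp: F_def fun_eq_iff abs_mult)
    then show ?thesis using kernel True by (simp only: greaterThanLessThan_iff)
  next
    case False
    then have e0: "e s = 0" by (simp add: e_def)
    then have "F s = (\<lambda>r. 0)" by (auto simp: F_def fun_eq_iff)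
    then show ?thesis using e0 by (simp add: has_bochner_integral_zero)
  qed
  have FI: "integrable (lborel \<Otimes>\<^sub>M lborel) (case_prod F)"
  proof (rule lborel_pair.Fubini_integrable)
    show "case_prod F \<in> borel_measurable (lborel \<Otimes>\<^sub>M lborel)"
      unfolding F_def by measurable
    have "(\<lambda>s. LBINT r. norm (case_prod F (s, r))) = (\<lambda>s. \<bar>e s\<bar> * B)"
      using F1 by (auto simp: has_bochner_integral_iff)
    then show "integrable lborel (\<lambda>s. LBINT r. norm (case_prod F (s, r)))"
      using e by simp
    show "AE s in lborel. integrable lborel (\<lambda>r. case_prod F (s, r))"
      using F1 by (auto simp: has_bochner_integral_iff)
  qed
  have "(LBINT s. (LBINT r. F s r)) = (LBINT s. e s * B)"
    using F1 by (auto simp: has_bochner_integral_iff)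
  also have "\<dots> = (S t - S 0) * B" by (simp add: e_int)
  finally have 1: "(LBINT r. (LBINT s. F s r)) = (S t - S 0) * B"
    using lborel_pair.Fubini_integral[OF FI] by simp
  have 2: "(LBINT s. F s r) = indicator {0<..<t} r *\<^sub>R ((- \<mu> * Gamma (1 - \<alpha>)) * ((t - r) powr (\<alpha> - 1) * S r))" for r
  proof (cases "r \<in> {0<..<t}")
    case True
    then have "F s r = (t - r) powr (\<alpha> - 1) * (indicator {0<..<r} s *\<^sub>R ((r - s) powr (- \<alpha>) * d s))" for s
      by (auto simp: F_def e_def indicator_def)
    then have "(LBINT s. F s r) = (t - r) powr (\<alpha> - 1) * (LBINT s:{0<..<r}. (r - s) powr (- \<alpha>) * d s)"
      by (simp add: set_lebesgue_integral_def)
    also have "(LBINT s:{0<..<r}. (r - s) powr (- \<alpha>) * d s) = - \<mu> * Gamma (1 - \<alpha>) * S r"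
      using eq[of r] True t G by (simp add: field_simps)
    finally show ?thesis using True by simp
  next
    case False
    then have "F s r = 0" for s by (auto simp: F_def e_def indicator_def)
    then show ?thesis using False by simp
  qed
  have cancel: "x * b = - m * i" if "x * (a * b) = (- m * a) * i" "a \<noteq> 0" for x a b m i :: real
  proof -
    have "a * (x * b + m * i) = 0" using that(1) by (simp add: algebra_simps)
    then show ?thesis using that(2) by simp
  qed
  have "(S t - S 0) * B = (- \<mu> * Gamma (1 - \<alpha>)) * (LBINT r:{0<..<t}. (t - r) powr (\<alpha> - 1) * S r)"
    unfolding set_integral_mult_right[symmetric] unfolding set_lebesgue_integral_def using 1[symmetric] unfolding 2 .
  then have "(S t - S 0) * Gamma \<alpha> = - \<mu> * (LBINT r:{0<..<t}. (t - r) powr (\<alpha> - 1) * S r)"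
    using G unfolding B by (intro cancel) auto
  then show ?thesis using G by (simp add: field_simps)
qed

section \<open>Modes of a solution\<close>

lemma norm_le_H2_norm: "norm v \<le> H2_norm v"
  unfolding H2_norm_def by (rule real_le_rsqrt) simp

lemma tendsto_dom_L_imp_tendsto:
  assumes "tendsto_dom_L u l F"
  shows "(u \<longlongrightarrow> l) F"
proof -
  have "((\<lambda>t. u t - l) \<longlongrightarrow> 0) F"
  proof (rule Lim_null_comparison)
    show "((\<lambda>t. H2_norm (u t - l)) \<longlongrightarrow> 0) F" using assms by (simp add: tendsto_dom_L_def)
  qed (simp add: norm_le_H2_norm)
  then show ?thesis by (simp add: LIM_zero_iff)
qed

context nonneg_potential
begin

section \<open>Values, gluing and modes of one fixed solution\<close>

context
  fixes \<alpha> p q :: real and \<phi> \<psi> f :: L2 and u :: "real \<Rightarrow> L2"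
  assumes \<alpha>: "0 < \<alpha>" "\<alpha> \<le> 1" and p: "0 < p" and q: "0 < q" and sol: "solves_problem1 \<alpha> p q g \<phi> \<psi> u f"
begin

lemma solution_continuous: "continuous_on {-p..q} u"
  using sol tendsto_dom_L_imp_tendsto
  unfolding solves_problem1_def continuous_on_dom_L_def continuous_on_def by blast

lemma solution_endpoints: "u (-p) = \<psi>" "u q = \<phi>"
proof -
  have c: "(u \<longlongrightarrow> u (-p)) (at_right (-p))" "(u \<longlongrightarrow> u q) (at_left q)"
    using solution_continuous[unfolded continuous_on_def, rule_format, of "-p"]
      solution_continuous[unfolded continuous_on_def, rule_format, of q]
      at_within_Icc_at_right[of "-p" q] at_within_Icc_at_left[of "-p" q] p q by simp_all
  have l: "(u \<longlongrightarrow> \<psi>) (at_right (-p))" "(u \<longlongrightarrow> \<phi>) (at_left q)"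
    using sol by (auto simp: solves_problem1_def intro: tendsto_dom_L_imp_tendsto)
  show "u (-p) = \<psi>" using c(1) l(1) by (rule tendsto_unique[rotated]) simp
  show "u q = \<phi>" using c(2) l(2) by (rule tendsto_unique[rotated]) simp
qed

text \<open>Limits become values because \<open>caputo\<close> is continuous up to 0 from the right
  and \<open>time_deriv\<close> from the left. In this form the fractional equation at t = 0
  provides the velocity with which the oscillator on the left starts.\<close>

lemma solution_gluing: "caputo \<alpha> p q u 0 = time_deriv p q u 0"
proof -
  obtain l where l: "(caputo \<alpha> p q u \<longlongrightarrow> l) (at_right 0)" "(time_deriv p q u \<longlongrightarrow> l) (at_left 0)"
    using sol unfolding solves_problem1_def by blast
  have c: "continuous_on {0..q} (caputo \<alpha> p q u)" "continuous_on {-p..0} (time_deriv p q u)"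
    using sol unfolding solves_problem1_def by blast+
  have "(caputo \<alpha> p q u \<longlongrightarrow> caputo \<alpha> p q u 0) (at_right 0)" "(time_deriv p q u \<longlongrightarrow> time_deriv p q u 0) (at_left 0)"
    using c(1)[unfolded continuous_on_def, rule_format, of 0] c(2)[unfolded continuous_on_def, rule_format, of 0]
      at_within_Icc_at_right[of 0 q] at_within_Icc_at_left[of "-p" 0] p q by simp_all
  then have "caputo \<alpha> p q u 0 = l" "time_deriv p q u 0 = l"
    using l by (auto intro: tendsto_unique[rotated])
  then show ?thesis by simp
qed

context
  fixes \<omega> :: L2 and \<mu> :: real
  assumes \<omega>: "\<omega> \<in> dom_L" "\<omega> \<noteq> 0" "- op_L g \<omega> = \<mu> *\<^sub>R \<omega>"
begin

text \<open>The shift by (f, \<omega>) / \<mu> absorbs the source term, so that both evolution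
  equations become homogeneous in the shifted mode.\<close>

lemma mode_op_L:
  assumes "t \<in> {-p..q}"
  shows "inner (op_L g (u t)) \<omega> + inner f \<omega> = - \<mu> * (inner (u t) \<omega> - inner f \<omega> / \<mu>)"
proof -
  have "u t \<in> dom_L"
    using sol assms unfolding solves_problem1_def continuous_on_dom_L_def by blast
  then have "inner (op_L g (u t)) \<omega> = - inner (u t) (- op_L g \<omega>)"
    using op_L_symmetric \<omega>(1) by simp
  then have "inner (op_L g (u t)) \<omega> = - (\<mu> * inner (u t) \<omega>)" unfolding \<omega>(3) by simp
  then show ?thesis using eigenvalue_ge_1[OF \<omega>] by (simp add: field_simps)
qed

lemma mode_caputo:
  assumes "t \<in> {0..q}"
  shows "inner (caputo \<alpha> p q u t) \<omega> = - \<mu> * (inner (u t) \<omega> - inner f \<omega> / \<mu>)"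
proof -
  have "inner (caputo \<alpha> p q u t) \<omega> - inner (op_L g (u t)) \<omega> = inner f \<omega>"
    using sol assms \<omega>(1) unfolding solves_problem1_def by blast
  then show ?thesis using mode_op_L[of t] assms p by simp
qed

lemma mode_right:
  assumes t: "t \<in> {0<..q}"
  shows "inner (u t) \<omega> - inner f \<omega> / \<mu> =
    (inner (u 0) \<omega> - inner f \<omega> / \<mu>) * mittag_leffler \<alpha> 1 (- \<mu> * t powr \<alpha>)"
proof -
  define S where "S t = inner (u t) \<omega> - inner f \<omega> / \<mu>" for t
  define d where "d t = inner (time_deriv p q u t) \<omega>" for t
  have S: "continuous_on {0..q} S"
    unfolding S_def using p by (intro continuous_intros continuous_on_subset[OF solution_continuous]) auto
  have d: "DERIV S s :> d s" if "s \<in> {0<..<q}" for s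
  proof -
    have "u differentiable (at s within {0..q})"
      using sol that unfolding solves_problem1_def by auto
    then have "(u has_vector_derivative time_deriv p q u s) (at s)"
      using that by (simp add: vector_derivative_works time_deriv_def at_within_Icc_at)
    from bounded_linear.has_vector_derivative[OF bounded_linear_inner_left this, of \<omega>]
    have "((\<lambda>t. inner (u t) \<omega>) has_real_derivative d s) (at s)"
      by (simp add: d_def has_real_derivative_iff_has_vector_derivative)
    then show ?thesis unfolding S_def by (auto intro!: derivative_eq_intros)
  qed
  have "S t = S 0 - \<mu> / Gamma \<alpha> * (LBINT s:{0<..<t}. (t - s) powr (\<alpha> - 1) * S s)" if t: "t \<in> {0<..q}" for t
  proof (cases "\<alpha> = 1")
    case True
    have "DERIV S s :> - \<mu> * S s" if s: "s \<in> {0<..<q}" for s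
    proof -
      have "caputo \<alpha> p q u s = time_deriv p q u s" using True s by (simp add: caputo_def)
      then have "d s = - \<mu> * S s" using mode_caputo[of s] s by (simp add: d_def S_def)
      then show ?thesis using d[OF s] by simp
    qed
    from ode_imp_abel_equation[OF S this t] show ?thesis using True by simp
  next
    case False
    then have \<alpha>1: "\<alpha> < 1" using \<alpha> by simp
    have int: "set_integrable lborel {0<..<r} (caputo_integrand \<alpha> p q u r)" if "r \<in> {0<..q}" for r
      using sol \<alpha>1 that unfolding solves_problem1_def by blast
    \<comment> \<open>Pairing with \<omega> is a bounded linear map, so it passes under the Bochner
      integral and reduces the Caputo derivative of u to that of its mode.\<close>
    have integrand: "inner (indicator {0<..<r} s *\<^sub>R caputo_integrand \<alpha> p q u r s) \<omega>
        = indicator {0<..<r} s *\<^sub>R ((r - s) powr (- \<alpha>) * d s)" for r s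
      by (simp add: caputo_integrand_def d_def)
    show ?thesis
    proof (rule caputo_imp_abel_equation[OF \<alpha>(1) \<alpha>1 S d _ _ _ t])
      show "continuous_on {0<..q} d"
        unfolding d_def using sol by (intro continuous_intros) (auto simp: solves_problem1_def)
      fix r assume r: "r \<in> {0<..q}"
      show "set_integrable lborel {0<..<r} (\<lambda>s. (r - s) powr (- \<alpha>) * d s)"
        using integrable_inner_left[OF int[OF r, unfolded set_integrable_def], of \<omega>]
        unfolding integrand set_integrable_def .
      have "inner (LBINT s:{0<..<r}. caputo_integrand \<alpha> p q u r s) \<omega> = (LBINT s:{0<..<r}. (r - s) powr (- \<alpha>) * d s)"
        unfolding set_lebesgue_integral_def integrand[symmetric]
        using int[OF r] by (intro integral_inner_left[symmetric]) (simp add: set_integrable_def)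
      then show "1 / Gamma (1 - \<alpha>) * (LBINT s:{0<..<r}. (r - s) powr (- \<alpha>) * d s) = - \<mu> * S r"
        using mode_caputo[of r] r False by (simp add: caputo_def S_def)
    qed
  qed
  from abel_equation_solution[OF \<alpha>(1) _ S this t] show ?thesis
    using eigenvalue_ge_1[OF \<omega>] by (simp add: S_def)
qed

lemma mode_left:
  assumes t: "t \<in> {-p..0}"
  shows "inner (u t) \<omega> - inner f \<omega> / \<mu> =
    (inner (u 0) \<omega> - inner f \<omega> / \<mu>) * (cos (sqrt \<mu> * t) - sqrt \<mu> * sin (sqrt \<mu> * t))"
proof -
  define S where "S t = inner (u t) \<omega> - inner f \<omega> / \<mu>" for t
  define d where "d t = inner (time_deriv p q u t) \<omega>" for t
  have \<mu>: "\<mu> \<ge> 1" by (rule eigenvalue_ge_1[OF \<omega>])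
  have "S t = S 0 * cos (sqrt \<mu> * t) + d 0 / sqrt \<mu> * sin (sqrt \<mu> * t)"
  proof (rule oscillator_solution[OF p _ _ _ _ t])
    show "sqrt \<mu> > 0" using \<mu> by simp
    show "(S has_real_derivative d s) (at s within {-p..0})" if "s \<in> {-p..0}" for s
    proof -
      have "u differentiable (at s within {-p..0})"
        using sol that unfolding solves_problem1_def by blast
      then have "(u has_vector_derivative time_deriv p q u s) (at s within {-p..0})"
        using that by (simp add: vector_derivative_works time_deriv_def)
      from bounded_linear.has_vector_derivative[OF bounded_linear_inner_left this, of \<omega>]
      have "((\<lambda>t. inner (u t) \<omega>) has_real_derivative d s) (at s within {-p..0})"
        by (simp add: d_def has_real_derivative_iff_has_vector_derivative)
      then show ?thesis unfolding S_def by (auto intro!: derivative_eq_intros)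
    qed
    show "continuous_on {-p..0} d"
      unfolding d_def using sol by (intro continuous_intros) (auto simp: solves_problem1_def)
    show "(d has_real_derivative - (sqrt \<mu>)\<^sup>2 * S s) (at s)" if s: "s \<in> {-p<..<0}" for s
    proof -
      have "time_deriv p q u differentiable (at s)"
        using sol s unfolding solves_problem1_def by blast
      then have "(time_deriv p q u has_vector_derivative time_deriv2 p q u s) (at s)"
        by (simp add: vector_derivative_works time_deriv2_def)
      from bounded_linear.has_vector_derivative[OF bounded_linear_inner_left this, of \<omega>]
      have "(d has_real_derivative inner (time_deriv2 p q u s) \<omega>) (at s)"
        by (simp add: d_def[abs_def] has_real_derivative_iff_has_vector_derivative)
      moreover have "inner (time_deriv2 p q u s) \<omega> - inner (op_L g (u s)) \<omega> = inner f \<omega>"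
        using sol s \<omega>(1) unfolding solves_problem1_def by blast
      then have "inner (time_deriv2 p q u s) \<omega> = - (sqrt \<mu>)\<^sup>2 * S s"
        using mode_op_L[of s] s q \<mu> by (simp add: S_def)
      ultimately show ?thesis by simp
    qed
  qed
  \<comment> \<open>The two time intervals meet here: gluing turns the fractional equation at t = 0
    into the velocity -\<mu> S(0) from the left.\<close>
  moreover have "d 0 / sqrt \<mu> = - (sqrt \<mu> * S 0)"
  proof -
    have "d 0 = - \<mu> * S 0"
      using mode_caputo[of 0] q solution_gluing by (simp add: d_def S_def)
    then have "d 0 / sqrt \<mu> = - (\<mu> / sqrt \<mu> * S 0)" by simp
    then show ?thesis using \<mu> by (simp add: real_div_sqrt)
  qed
  ultimately show ?thesis by (simp add: S_def algebra_simps)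
qed

text \<open>The unknown (f, \<omega>) / \<mu> enters S(q) and S(-p) alike and cancels in their
  difference, which leaves data on one side and S(0) on the other; the sine changes sign at
  -p.\<close>

lemma mode_Delta: "inner \<phi> \<omega> - inner \<psi> \<omega> = (inner (u 0) \<omega> - inner f \<omega> / \<mu>) * Delta \<alpha> p q \<mu>"
  using mode_right[of q] mode_left[of "-p"] p q solution_endpoints
  by (simp add: Delta_def algebra_simps)

end
end
end

theorem theorem3p1:
  fixes \<alpha> p q :: real and g :: "real \<Rightarrow> real" and ev :: "nat \<Rightarrow> real"
    and \<phi> \<psi> f\<^sub>1 f\<^sub>2 :: L2 and u\<^sub>1 u\<^sub>2 :: "real \<Rightarrow> L2"
  assumes "0 < \<alpha>" and "\<alpha> \<le> 1" and "0 < p" and "0 < q"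
    and "g \<in> Linfty" and "AE x in unit_meas. 0 \<le> g x"
    and "strict_mono_on {1..} ev" and "ev ` {1..} = eigenvalues_neg_L g"
    and "\<And>k. k \<ge> 1 \<Longrightarrow> Delta \<alpha> p q (ev k) \<noteq> 0"
    and "solves_problem1 \<alpha> p q g \<phi> \<psi> u\<^sub>1 f\<^sub>1"
    and "solves_problem1 \<alpha> p q g \<phi> \<psi> u\<^sub>2 f\<^sub>2"
  shows "(\<forall>t\<in>{-p..q}. u\<^sub>1 t = u\<^sub>2 t) \<and> f\<^sub>1 = f\<^sub>2"
proof -
  interpret nonneg_potential g by unfold_locales (use assms in auto)
  have modes: "inner f\<^sub>1 \<omega> = inner f\<^sub>2 \<omega> \<and> (\<forall>t\<in>{-p..q}. inner (u\<^sub>1 t) \<omega> = inner (u\<^sub>2 t) \<omega>)"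
    if \<omega>: "\<omega> \<in> dom_L" "\<omega> \<noteq> 0" "- op_L g \<omega> = \<mu> *\<^sub>R \<omega>" for \<omega> \<mu>
  proof -
    note m1 = assms(1-4,10) \<omega> and m2 = assms(1-4,11) \<omega>
    have "\<mu> \<in> ev ` {1..}" using \<omega> assms(8) by (auto simp: eigenvalues_neg_L_def)
    then have "Delta \<alpha> p q \<mu> \<noteq> 0" using assms(9) by auto
    then have a: "inner (u\<^sub>1 0) \<omega> - inner f\<^sub>1 \<omega> / \<mu> = inner (u\<^sub>2 0) \<omega> - inner f\<^sub>2 \<omega> / \<mu>"
      using mode_Delta[OF m1] mode_Delta[OF m2] by simp
    have q: "q \<in> {0<..q}" using assms(4) by simp
    \<comment> \<open>Both solutions equal \<phi> at t = q, so once the values S(0) agree, (f,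
      \<omega>) is the only unknown left in the mode at q.\<close>
    have "inner \<phi> \<omega> - inner f\<^sub>1 \<omega> / \<mu> = inner \<phi> \<omega> - inner f\<^sub>2 \<omega> / \<mu>"
      using mode_right[OF m1 q] mode_right[OF m2 q] unfolding a
        solution_endpoints(2)[OF assms(1-4,10)] solution_endpoints(2)[OF assms(1-4,11)] by (simp only:)
    then have f: "inner f\<^sub>1 \<omega> = inner f\<^sub>2 \<omega>" using eigenvalue_ge_1[OF \<omega>] by simp
    have "inner (u\<^sub>1 t) \<omega> = inner (u\<^sub>2 t) \<omega>" if t: "t \<in> {-p..q}" for t
    proof (cases "t \<le> 0")
      case True
      then have t': "t \<in> {-p..0}" using t by simp
      have "inner (u\<^sub>1 t) \<omega> - inner f\<^sub>1 \<omega> / \<mu> = inner (u\<^sub>2 t) \<omega> - inner f\<^sub>2 \<omega> / \<mu>"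
        unfolding mode_left[OF m1 t'] mode_left[OF m2 t'] a ..
      then show ?thesis using f by simp
    next
      case False
      then have t': "t \<in> {0<..q}" using t by simp
      have "inner (u\<^sub>1 t) \<omega> - inner f\<^sub>1 \<omega> / \<mu> = inner (u\<^sub>2 t) \<omega> - inner f\<^sub>2 \<omega> / \<mu>"
        unfolding mode_right[OF m1 t'] mode_right[OF m2 t'] a ..
      then show ?thesis using f by simp
    qed
    then show ?thesis using f by blast
  qed
  have "u\<^sub>1 t - u\<^sub>2 t = 0" if "t \<in> {-p..q}" for t
    using modes that by (intro eigenfunctions_complete) (simp add: inner_diff_left)
  moreover have "f\<^sub>1 - f\<^sub>2 = 0"
    using modes by (intro eigenfunctions_complete) (simp add: inner_diff_left)
  ultimately show ?thesis by simp
qed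

end
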